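(* Let $\mathsf{V}=(\mathsf{V},\otimes,k)$ be a commutative quantale, let $X,Y,Z$ be complete $\mathsf{V}$-categories, and let $(X,Y,Z,\circledast,\swarrow,\searrow)$ be a two-variable adjunction in $\mathsf{V}\text{-}\mathbf{Cat}$. Let $A,B$ be $\mathsf{V}$-categories and let $\zeta\colon A^{\mathrm{op}}\otimes B\to X$ be a $\mathsf{V}$-bifunctor. Then a $\mathsf{V}$-category $C$ is equivalent to $\mathsf{K}^{\dagger}\zeta$ if, and only if, $C$ is complete and there exist a dense $\mathsf{V}$-bifunctor $\beta\colon B\otimes Z^{\mathrm{op}}\to C$ and a codense $\mathsf{V}$-bifunctor $\alpha\colon A\otimes Y^{\mathrm{op}}\to C$ such that $$C(\beta(b,z),\alpha(a,y))=X(\zeta(a,b),z\swarrow y)$$ for all $a\in A$, $b\in B$, $y\in Y$, $z\in Z$.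
   Context: A commutative quantale is a commutative monoid $(\mathsf{V},\otimes,k)$ whose underlying set is a complete lattice with $x\otimes\bigvee_i y_i=\bigvee_i x\otimes y_i$; the implication $\to$ is defined by $x\otimes y\leq z\iff x\leq y\to z$. A $\mathsf{V}$-category is a set $X$ with a map $X(-,-)\colon X\times X\to\mathsf{V}$ such that $k\leq X(x,x)$ and $X(x,y)\otimes X(y,z)\leq X(x,z)$. Its underlying preorder is $x\leq y\iff k\leq X(x,y)$; $x\cong y$ means $x\leq y$ and $y\leq x$. A $\mathsf{V}$-functor $f\colon X\to Y$ is a map with $X(x,y)\leq Y(fx,fy)$; $\mathsf{V}$-functors are ordered pointwise ($f\leq g$ iff $fx\leq gx$ for all $x$). Two $\mathsf{V}$-categories $X,Y$ are equivalent if there are $\mathsf{V}$-functors $f\colon X\to Y$, $g\colon Y\to X$ with $gf\cong 1_X$ and $fg\cong 1_Y$. $\mathsf{V}$ is a $\mathsf{V}$-category via $\mathsf{V}(x,y)=x\to y$. $X^{\mathrm{op}}$ has the same objects with $X^{\mathrm{op}}(x,y)=X(y,x)$. $X\otimes Y$ has object set $X\times Y$ and $(X\otimes Y)((x,y),(x',y'))=X(x,x')\otimes Y(y,y')$. $Y^X$ is the $\mathsf{V}$-category of $\mathsf{V}$-functors $X\to Y$ with $Y^X(f,g)=\bigwedge_{x\in X}Y(fx,gx)$. A $\mathsf{V}$-bifunctor is a $\mathsf{V}$-functor $X\otimes Y\to Z$. A two-variable adjunction $(X,Y,Z,\circledast,\swarrow,\searrow)$ in $\mathsf{V}\text{-}\mathbf{Cat}$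 consists of $\mathsf{V}$-bifunctors $\circledast\colon X\otimes Y\to Z$, $\swarrow\colon Z\otimes Y^{\mathrm{op}}\to X$, $\searrow\colon X^{\mathrm{op}}\otimes Z\to Y$ such that $Z(x\circledast y,z)=X(x,z\swarrow y)=Y(y,x\searrow z)$ for all $x\in X$, $y\in Y$, $z\in Z$. A supremum of $\mu\in\mathsf{V}^{X^{\mathrm{op}}}$ is an object $\sup\mu\in X$ with $X(\sup\mu,x)=\bigwedge_{y\in X}\mu y\to X(y,x)$ for all $x\in X$; an infimum of $\lambda\in\mathsf{V}^X$ is an object $\inf\lambda\in X$ with $X(x,\inf\lambda)=\bigwedge_{y\in X}\lambda y\to X(x,y)$ for all $x\in X$. $X$ is complete if every $\lambda\in\mathsf{V}^X$ has an infimum; equivalently every $\mu\in\mathsf{V}^{X^{\mathrm{op}}}$ has a supremum. In a complete $\mathsf{V}$-category all joins and meets exist in the underlying preorder (determined up to $\cong$; $\bigvee,\bigwedge$ denote chosen ones), and $X(x,\bigwedge_i y_i)=\bigwedge_i X(x,y_i)$, $X(\bigvee_i y_i,x)=\bigwedge_i X(y_i,x)$. A $\mathsf{V}$-functor $f\colon X\to Y$ is dense if for every $y\in Y$ there is $\mu\in\mathsf{V}^{X^{\mathrm{op}}}$ such that $y$ is a supremum of the presheaf $y'\mapsto\bigvee_{x\in X}Y(y',fx)\otimes\mu x$ on $Y$; it is codense if for every $y\in Y$ there is $\lambda\in\mathsf{V}^X$ such that $y$ is an infimum of the copresheaf $y'\mapsto\bigvee_{x\in X}Y(fx,y')\otimes\lambda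 x$ on $Y$. For $\zeta\colon A^{\mathrm{op}}\otimes B\to X$ define $\mathsf{V}$-functors $$\zeta_{\dagger}\colon(Z^B)^{\mathrm{op}}\to(Y^A)^{\mathrm{op}},\ (\zeta_{\dagger}\lambda)a=\bigwedge_{b\in B}\zeta(a,b)\searrow\lambda b,\qquad \zeta^{\dagger}\colon(Y^A)^{\mathrm{op}}\to(Z^B)^{\mathrm{op}},\ (\zeta^{\dagger}\mu)b=\bigvee_{a\in A}\zeta(a,b)\circledast\mu a,$$ with meets and joins taken in the underlying preorders of $Y$ and $Z$. Then $\mathsf{K}^{\dagger}\zeta:=\{\lambda\in Z^B\mid\zeta^{\dagger}\zeta_{\dagger}\lambda\cong\lambda\}$, a $\mathsf{V}$-category with the hom inherited from $(Z^B)^{\mathrm{op}}$. *)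

theory Defs
  imports Main "HOL-Library.FuncSet"
begin

text \<open>
  The tensor of a commutative quantale is written \<open>*\<close> and its unit \<open>1\<close>; no relation between
  the unit and the top element is assumed.
\<close>

class comm_quantale = complete_lattice + comm_monoid_mult +
  assumes times_Sup_distrib: "x * Sup S = Sup ((\<lambda>y. x * y) ` S)"

definition qimp :: "'v::comm_quantale \<Rightarrow> 'v \<Rightarrow> 'v" where
  "qimp y z = Sup {x. x * y \<le> z}"

lemma times_le_iff_le_qimp:
  fixes x y z :: "'v::comm_quantale"
  shows "x * y \<le> z \<longleftrightarrow> x \<le> qimp y z"
proof
  assume "x * y \<le> z"
  then show "x \<le> qimp y z" unfolding qimp_def by (intro Sup_upper) simp
next
  assume *: "x \<le> qimp y z"
  have "y * sup x (qimp y z) = sup (y * x) (y * qimp y z)"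
    using times_Sup_distrib[of y "{x, qimp y z}"] by simp
  then have "y * x \<le> y * qimp y z"
    using * by (simp add: sup_absorb2 le_iff_sup)
  also have "y * qimp y z \<le> z"
    unfolding qimp_def times_Sup_distrib by (rule Sup_least) (auto simp: mult.commute)
  finally show "x * y \<le> z" by (simp add: mult.commute)
qed

text \<open>
  A V-category lives on a (possibly empty) set of objects; the values of \<open>vhom\<close> outside that
  set carry no meaning.
\<close>

record ('a, 'v) vcat =
  vobj :: "'a set"
  vhom :: "'a \<Rightarrow> 'a \<Rightarrow> 'v"

definition vcategory :: "('a, 'v::comm_quantale) vcat \<Rightarrow> bool" where
  "vcategory X \<longleftrightarrow>
     (\<forall>x\<in>vobj X. 1 \<le> vhom X x x) \<and>
     (\<forall>x\<in>vobj X. \<forall>y\<in>vobj X. \<forall>z\<in>vobj X. vhom X x y * vhom X y z \<le> vhom X x z)"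

definition vle :: "('a, 'v::comm_quantale) vcat \<Rightarrow> 'a \<Rightarrow> 'a \<Rightarrow> bool" where
  "vle X x y \<longleftrightarrow> 1 \<le> vhom X x y"

definition viso :: "('a, 'v::comm_quantale) vcat \<Rightarrow> 'a \<Rightarrow> 'a \<Rightarrow> bool" where
  "viso X x y \<longleftrightarrow> vle X x y \<and> vle X y x"

definition vfunctor ::
  "('a, 'v::comm_quantale) vcat \<Rightarrow> ('b, 'v) vcat \<Rightarrow> ('a \<Rightarrow> 'b) \<Rightarrow> bool" where
  "vfunctor X Y f \<longleftrightarrow>
     f \<in> vobj X \<rightarrow> vobj Y \<and>
     (\<forall>x\<in>vobj X. \<forall>y\<in>vobj X. vhom X x y \<le> vhom Y (f x) (f y))"

definition vfun_le ::
  "('a, 'v::comm_quantale) vcat \<Rightarrow> ('b, 'v) vcat \<Rightarrow> ('a \<Rightarrow> 'b) \<Rightarrow> ('a \<Rightarrow> 'b) \<Rightarrow> bool" where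
  "vfun_le X Y f g \<longleftrightarrow> (\<forall>x\<in>vobj X. vle Y (f x) (g x))"

definition vfun_iso ::
  "('a, 'v::comm_quantale) vcat \<Rightarrow> ('b, 'v) vcat \<Rightarrow> ('a \<Rightarrow> 'b) \<Rightarrow> ('a \<Rightarrow> 'b) \<Rightarrow> bool" where
  "vfun_iso X Y f g \<longleftrightarrow> vfun_le X Y f g \<and> vfun_le X Y g f"

definition vequivalent ::
  "('a, 'v::comm_quantale) vcat \<Rightarrow> ('b, 'v) vcat \<Rightarrow> bool" where
  "vequivalent X Y \<longleftrightarrow>
     (\<exists>f g. vfunctor X Y f \<and> vfunctor Y X g \<and>
        vfun_iso X X (g \<circ> f) id \<and> vfun_iso Y Y (f \<circ> g) id)"

definition vbase :: "('v::comm_quantale, 'v) vcat" where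
  "vbase = \<lparr>vobj = UNIV, vhom = qimp\<rparr>"

definition vop :: "('a, 'v::comm_quantale) vcat \<Rightarrow> ('a, 'v) vcat" where
  "vop X = \<lparr>vobj = vobj X, vhom = (\<lambda>x y. vhom X y x)\<rparr>"

definition vtensor ::
  "('a, 'v::comm_quantale) vcat \<Rightarrow> ('b, 'v) vcat \<Rightarrow> ('a \<times> 'b, 'v) vcat" where
  "vtensor X Y =
     \<lparr>vobj = vobj X \<times> vobj Y,
      vhom = (\<lambda>(x, y) (x', y'). vhom X x x' * vhom Y y y')\<rparr>"

text \<open>
  Objects of the functor category \<open>Y\<^sup>X\<close> are taken to be extensional, so that each V-functor
  is represented by exactly one HOL function.
\<close>

definition vfun_cat ::
  "('a, 'v::comm_quantale) vcat \<Rightarrow> ('b, 'v) vcat \<Rightarrow> ('a \<Rightarrow> 'b, 'v) vcat" where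
  "vfun_cat X Y =
     \<lparr>vobj = {f \<in> extensional (vobj X). vfunctor X Y f},
      vhom = (\<lambda>f g. INF x\<in>vobj X. vhom Y (f x) (g x))\<rparr>"

definition two_variable_adjunction ::
  "('x, 'v::comm_quantale) vcat \<Rightarrow> ('y, 'v) vcat \<Rightarrow> ('z, 'v) vcat \<Rightarrow>
   ('x \<times> 'y \<Rightarrow> 'z) \<Rightarrow> ('z \<times> 'y \<Rightarrow> 'x) \<Rightarrow> ('x \<times> 'z \<Rightarrow> 'y) \<Rightarrow> bool" where
  "two_variable_adjunction X Y Z ostar sw se \<longleftrightarrow>
     vfunctor (vtensor X Y) Z ostar \<and>
     vfunctor (vtensor Z (vop Y)) X sw \<and>
     vfunctor (vtensor (vop X) Z) Y se \<and>
     (\<forall>x\<in>vobj X. \<forall>y\<in>vobj Y. \<forall>z\<in>vobj Z.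
        vhom Z (ostar (x, y)) z = vhom X x (sw (z, y)) \<and>
        vhom X x (sw (z, y)) = vhom Y y (se (x, z)))"

definition is_vsup :: "('a, 'v::comm_quantale) vcat \<Rightarrow> ('a \<Rightarrow> 'v) \<Rightarrow> 'a \<Rightarrow> bool" where
  "is_vsup X \<mu> s \<longleftrightarrow>
     s \<in> vobj X \<and>
     (\<forall>x\<in>vobj X. vhom X s x = (INF y\<in>vobj X. qimp (\<mu> y) (vhom X y x)))"

definition is_vinf :: "('a, 'v::comm_quantale) vcat \<Rightarrow> ('a \<Rightarrow> 'v) \<Rightarrow> 'a \<Rightarrow> bool" where
  "is_vinf X \<phi> i \<longleftrightarrow>
     i \<in> vobj X \<and>
     (\<forall>x\<in>vobj X. vhom X x i = (INF y\<in>vobj X. qimp (\<phi> y) (vhom X x y)))"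

definition vcomplete :: "('a, 'v::comm_quantale) vcat \<Rightarrow> bool" where
  "vcomplete X \<longleftrightarrow> (\<forall>\<phi>\<in>vobj (vfun_cat X vbase). \<exists>i. is_vinf X \<phi> i)"

definition vdense ::
  "('a, 'v::comm_quantale) vcat \<Rightarrow> ('b, 'v) vcat \<Rightarrow> ('a \<Rightarrow> 'b) \<Rightarrow> bool" where
  "vdense X Y f \<longleftrightarrow>
     (\<forall>y\<in>vobj Y. \<exists>\<mu>\<in>vobj (vfun_cat (vop X) vbase).
        is_vsup Y (\<lambda>y'. SUP x\<in>vobj X. vhom Y y' (f x) * \<mu> x) y)"

definition vcodense ::
  "('a, 'v::comm_quantale) vcat \<Rightarrow> ('b, 'v) vcat \<Rightarrow> ('a \<Rightarrow> 'b) \<Rightarrow> bool" where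
  "vcodense X Y f \<longleftrightarrow>
     (\<forall>y\<in>vobj Y. \<exists>\<phi>\<in>vobj (vfun_cat X vbase).
        is_vinf Y (\<lambda>y'. SUP x\<in>vobj X. vhom Y (f x) y' * \<phi> x) y)"

text \<open>
  Joins and meets in the underlying preorder are unique only up to isomorphism;
  \<open>vjoin\<close> and \<open>vmeet\<close> pick one. They are meaningful only when one exists, as is the case
  in complete V-categories.
\<close>

definition is_vjoin :: "('a, 'v::comm_quantale) vcat \<Rightarrow> 'a set \<Rightarrow> 'a \<Rightarrow> bool" where
  "is_vjoin X S j \<longleftrightarrow>
     j \<in> vobj X \<and> (\<forall>s\<in>S. vle X s j) \<and>
     (\<forall>u\<in>vobj X. (\<forall>s\<in>S. vle X s u) \<longrightarrow> vle X j u)"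

definition is_vmeet :: "('a, 'v::comm_quantale) vcat \<Rightarrow> 'a set \<Rightarrow> 'a \<Rightarrow> bool" where
  "is_vmeet X S m \<longleftrightarrow>
     m \<in> vobj X \<and> (\<forall>s\<in>S. vle X m s) \<and>
     (\<forall>u\<in>vobj X. (\<forall>s\<in>S. vle X u s) \<longrightarrow> vle X u m)"

definition vjoin :: "('a, 'v::comm_quantale) vcat \<Rightarrow> 'a set \<Rightarrow> 'a" where
  "vjoin X S = (SOME j. is_vjoin X S j)"

definition vmeet :: "('a, 'v::comm_quantale) vcat \<Rightarrow> 'a set \<Rightarrow> 'a" where
  "vmeet X S = (SOME m. is_vmeet X S m)"

definition lower_dagger ::
  "('a, 'v::comm_quantale) vcat \<Rightarrow> ('b, 'v) vcat \<Rightarrow> ('y, 'v) vcat \<Rightarrow>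
   ('x \<times> 'z \<Rightarrow> 'y) \<Rightarrow> ('a \<times> 'b \<Rightarrow> 'x) \<Rightarrow> ('b \<Rightarrow> 'z) \<Rightarrow> ('a \<Rightarrow> 'y)" where
  "lower_dagger A B Y se \<zeta> \<phi> =
     (\<lambda>a\<in>vobj A. vmeet Y ((\<lambda>b. se (\<zeta> (a, b), \<phi> b)) ` vobj B))"

definition upper_dagger ::
  "('a, 'v::comm_quantale) vcat \<Rightarrow> ('b, 'v) vcat \<Rightarrow> ('z, 'v) vcat \<Rightarrow>
   ('x \<times> 'y \<Rightarrow> 'z) \<Rightarrow> ('a \<times> 'b \<Rightarrow> 'x) \<Rightarrow> ('a \<Rightarrow> 'y) \<Rightarrow> ('b \<Rightarrow> 'z)" where
  "upper_dagger A B Z ostar \<zeta> \<mu> =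
     (\<lambda>b\<in>vobj B. vjoin Z ((\<lambda>a. ostar (\<zeta> (a, b), \<mu> a)) ` vobj A))"

definition K_dagger ::
  "('a, 'v::comm_quantale) vcat \<Rightarrow> ('b, 'v) vcat \<Rightarrow> ('y, 'v) vcat \<Rightarrow> ('z, 'v) vcat \<Rightarrow>
   ('x \<times> 'y \<Rightarrow> 'z) \<Rightarrow> ('x \<times> 'z \<Rightarrow> 'y) \<Rightarrow> ('a \<times> 'b \<Rightarrow> 'x) \<Rightarrow> ('b \<Rightarrow> 'z, 'v) vcat" where
  "K_dagger A B Y Z ostar se \<zeta> =
     \<lparr>vobj = {\<phi> \<in> vobj (vfun_cat B Z).
        vfun_iso B Z (upper_dagger A B Z ostar \<zeta> (lower_dagger A B Y se \<zeta> \<phi>)) \<phi>},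
      vhom = vhom (vop (vfun_cat B Z))\<rparr>"

end

theory Submission
  imports Defs
begin

text \<open>
  The homs of all V-categories involved are determined by a small amount of data, and both
  directions consist of computing homs through that data. Write \<open>up\<close> and \<open>lo\<close> for
  \<open>\<zeta>\<^sup>\<dagger>\<close> and \<open>\<zeta>\<^sub>\<dagger>\<close>. They form an enriched Galois connection (\<open>up_lo_adjunction\<close>):
  expanding the joins and meets, both \<open>Z(up \<mu> b, \<kappa> b)\<close> over all \<open>b\<close> and \<open>Y(\<mu> a, lo \<kappa> a)\<close> over
  all \<open>a\<close> become the meet of \<open>Y(\<mu> a, \<zeta>(a,b) \<searrow> \<kappa> b)\<close> over all \<open>(a,b)\<close>. Here \<open>K\<close> is the
  V-category of fixed points of \<open>up \<circ> lo\<close>.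

  In \<open>K\<close> the elements \<open>beta(b,z) = up (\<zeta>(-,b) \<searrow> z)\<close> and \<open>alpha(a,y) = \<zeta>(a,-) \<circledast> y\<close> represent
  evaluation: \<open>K(beta(b,z), \<kappa>) = Z(\<kappa> b, z)\<close> and \<open>K(\<kappa>, alpha(a,y)) = Y(y, lo \<kappa> a)\<close>
  (\<open>K_hom_beta\<close>, \<open>K_hom_alpha\<close>). Density and codensity are then the Yoneda lemma, applied in
  \<open>Z\<close> for each \<open>b\<close> and in \<open>Y\<close> for each \<open>a\<close>, and the formula for \<open>K(beta(b,z), alpha(a,y))\<close> is
  the two-variable adjunction. Limits in \<open>K\<close> are pointwise colimits in \<open>Z\<close>, because fixed points
  of \<open>up \<circ> lo\<close> are closed under them (\<open>K_has_wlim\<close>). All of this transports along an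
  equivalence.

  Conversely, in a V-category \<open>C\<close> with such \<open>\<beta>\<close> and \<open>\<alpha>\<close>, the formula for \<open>K(beta(b,z), \<kappa>)\<close>
  dictates what an object \<open>c\<close> must correspond to: the map \<open>coords c\<close> with
  \<open>Z(coords c b, z) = C(\<beta>(b,z), c)\<close>. Such values exist because codensity makes \<open>c\<close> a limit of
  objects \<open>\<alpha>(a,y)\<close>, for which \<open>\<zeta>(a,b) \<circledast> y\<close> is such a value. Density makes \<open>coords\<close> fully
  faithful. That \<open>coords c\<close> lies in \<open>K\<close>, and that every \<open>\<kappa>\<close> in \<open>K\<close> arises, both come from one
  computation (\<open>hom_\<beta>_wcolim\<close>): the colimit of \<open>\<beta>\<close> weighted by \<open>Z(\<kappa> b, z)\<close> has
  \<open>up (lo \<kappa>)\<close> as its coordinates.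

  The frequent tool is a reformulation of density: \<open>f\<close> is dense iff every object \<open>c\<close> is the
  colimit of \<open>f\<close> weighted by \<open>C(f -, c)\<close> (\<open>vdense_iff\<close>), so that \<open>C(c,x)\<close> can be computed from the
  homs out of the objects \<open>f d\<close>.
\<close>

section \<open>Implication in a commutative quantale\<close>

lemma quantale_mult_mono:
  fixes a b c d :: "'v::comm_quantale"
  assumes "a \<le> b" "c \<le> d"
  shows "a * c \<le> b * d"
proof -
  have 1: "x * z \<le> y * z" if "x \<le> y" for x y z :: 'v
    using that times_le_iff_le_qimp[of y z "y * z"] times_le_iff_le_qimp[of x z "y * z"] by auto
  have "a * c \<le> b * c" using 1 assms(1) .
  also have "\<dots> \<le> b * d" using 1[OF assms(2), of b] by (simp add: mult.commute)
  finally show ?thesis .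
qed

lemma qimp_antitone:
  fixes a b c :: "'v::comm_quantale"
  assumes "a \<le> b"
  shows "qimp b c \<le> qimp a c"
proof -
  have "qimp b c * a \<le> qimp b c * b" using assms by (intro quantale_mult_mono) auto
  also have "\<dots> \<le> c" by (simp add: times_le_iff_le_qimp)
  finally show ?thesis by (simp add: times_le_iff_le_qimp)
qed

lemma qimp_one [simp]: "qimp 1 c = (c :: 'v::comm_quantale)"
proof (rule antisym)
  show "qimp 1 c \<le> c" using times_le_iff_le_qimp[of "qimp 1 c" 1 c] by simp
  show "c \<le> qimp 1 c" using times_le_iff_le_qimp[of c 1 c] by simp
qed

lemma qimp_le_of_one_le:
  fixes a c :: "'v::comm_quantale"
  assumes "1 \<le> a"
  shows "qimp a c \<le> c"
  using qimp_antitone[OF assms, of c] by simp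

lemma one_le_qimp_iff: "1 \<le> qimp a c \<longleftrightarrow> a \<le> (c :: 'v::comm_quantale)"
  using times_le_iff_le_qimp[of 1 a c] by simp

lemma qimp_SUP:
  fixes c :: "'v::comm_quantale"
  shows "qimp (SUP i\<in>I. w i) c = (INF i\<in>I. qimp (w i) c)"
proof -
  have "v \<le> qimp (SUP i\<in>I. w i) c \<longleftrightarrow> v \<le> (INF i\<in>I. qimp (w i) c)" for v
  proof -
    have "v \<le> qimp (SUP i\<in>I. w i) c \<longleftrightarrow> (SUP i\<in>I. w i) * v \<le> c"
      by (simp add: times_le_iff_le_qimp[symmetric] mult.commute)
    also have "\<dots> \<longleftrightarrow> (\<forall>i\<in>I. w i * v \<le> c)" by (simp add: times_le_iff_le_qimp SUP_le_iff)
    also have "\<dots> \<longleftrightarrow> (\<forall>i\<in>I. v * w i \<le> c)" by (simp add: mult.commute)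
    also have "\<dots> \<longleftrightarrow> v \<le> (INF i\<in>I. qimp (w i) c)"
      by (simp add: times_le_iff_le_qimp le_INF_iff)
    finally show ?thesis .
  qed
  then show ?thesis by (meson antisym order_refl)
qed

lemma qimp_mult:
  fixes a b c :: "'v::comm_quantale"
  shows "qimp (a * b) c = qimp b (qimp a c)"
proof -
  have "v \<le> qimp (a * b) c \<longleftrightarrow> v \<le> qimp b (qimp a c)" for v
    by (simp add: times_le_iff_le_qimp[symmetric] ac_simps)
  then show ?thesis by (meson antisym order_refl)
qed

lemma qimp_INF:
  fixes a :: "'v::comm_quantale"
  shows "qimp a (INF i\<in>I. g i) = (INF i\<in>I. qimp a (g i))"
proof -
  have "v \<le> qimp a (INF i\<in>I. g i) \<longleftrightarrow> v \<le> (INF i\<in>I. qimp a (g i))" for v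
    by (simp add: times_le_iff_le_qimp[symmetric] le_INF_iff)
  then show ?thesis by (meson antisym order_refl)
qed

text \<open>
  The weight \<open>w\<close> can be pulled out of a pushed-forward presheaf; what remains inside the outer
  meet has the shape to which the Yoneda lemma applies.
\<close>

lemma INF_SUP_qimp_swap:
  fixes g :: "'i \<Rightarrow> 'j \<Rightarrow> 'v::comm_quantale"
  shows "(INF y\<in>J. qimp (SUP i\<in>I. g i y * w i) (h y)) =
         (INF i\<in>I. qimp (w i) (INF y\<in>J. qimp (g i y) (h y)))"
proof -
  have "(INF y\<in>J. qimp (SUP i\<in>I. g i y * w i) (h y)) =
        (INF y\<in>J. INF i\<in>I. qimp (w i) (qimp (g i y) (h y)))"
    by (simp add: qimp_SUP qimp_mult)
  also have "\<dots> = (INF i\<in>I. INF y\<in>J. qimp (w i) (qimp (g i y) (h y)))"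
    by (rule INF_commute)
  finally show ?thesis by (simp add: qimp_INF)
qed

lemma INF_Times:
  fixes g :: "'i \<times> 'j \<Rightarrow> 'w::complete_lattice"
  shows "(INF p\<in>I \<times> J. g p) = (INF i\<in>I. INF j\<in>J. g (i, j))"
  by (rule antisym) (auto intro!: INF_greatest intro: INF_lower INF_lower2)

section \<open>Basic V-category theory\<close>

lemma vop_simps [simp]:
  "vobj (vop X) = vobj X" "vhom (vop X) x y = vhom X y x" "vop (vop X) = X"
  by (simp_all add: vop_def)

lemma vtensor_simps [simp]:
  "vobj (vtensor X Y) = vobj X \<times> vobj Y"
  "vhom (vtensor X Y) (x, y) (x', y') = vhom X x x' * vhom Y y y'"
  by (simp_all add: vtensor_def)

lemma vbase_simps [simp]: "vobj vbase = UNIV" "vhom vbase = qimp"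
  by (simp_all add: vbase_def)

lemma vcategory_refl:
  assumes "vcategory X" "x \<in> vobj X"
  shows "1 \<le> vhom X x x"
  using assms by (simp add: vcategory_def)

lemma vcategory_comp:
  assumes "vcategory X" "x \<in> vobj X" "y \<in> vobj X" "z \<in> vobj X"
  shows "vhom X x y * vhom X y z \<le> vhom X x z"
  using assms by (simp add: vcategory_def)

lemma vcategory_vop: "vcategory X \<Longrightarrow> vcategory (vop X)"
  unfolding vcategory_def vop_simps by (metis mult.commute)

lemma vfunctor_obj: "vfunctor X Y f \<Longrightarrow> x \<in> vobj X \<Longrightarrow> f x \<in> vobj Y"
  by (auto simp: vfunctor_def)

lemma vfunctor_hom:
  "vfunctor X Y f \<Longrightarrow> x \<in> vobj X \<Longrightarrow> x' \<in> vobj X \<Longrightarrow> vhom X x x' \<le> vhom Y (f x) (f x')"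
  by (auto simp: vfunctor_def)

lemma vfunctor_vop: "vfunctor (vop X) (vop Y) f \<longleftrightarrow> vfunctor X Y f"
  by (auto simp: vfunctor_def)

lemma vhom_le_postcomp:
  assumes "vcategory X" "x \<in> vobj X" "y \<in> vobj X" "z \<in> vobj X" "vle X y z"
  shows "vhom X x y \<le> vhom X x z"
proof -
  have "vhom X x y * 1 \<le> vhom X x y * vhom X y z"
    using assms(5) by (intro quantale_mult_mono) (auto simp: vle_def)
  also have "\<dots> \<le> vhom X x z" using assms by (intro vcategory_comp)
  finally show ?thesis by simp
qed

lemma vhom_le_precomp:
  assumes "vcategory X" "x \<in> vobj X" "y \<in> vobj X" "z \<in> vobj X" "vle X x y"
  shows "vhom X y z \<le> vhom X x z"
  using vhom_le_postcomp[OF vcategory_vop[OF assms(1)], of z y x] assms by (simp add: vle_def)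

lemma vle_trans:
  assumes "vcategory X" "x \<in> vobj X" "y \<in> vobj X" "z \<in> vobj X" "vle X x y" "vle X y z"
  shows "vle X x z"
  using vhom_le_postcomp[OF assms(1-4,6)] assms(5) unfolding vle_def by (rule order_trans[rotated])

lemma vhom_viso_left:
  assumes "vcategory X" "x \<in> vobj X" "y \<in> vobj X" "z \<in> vobj X" "viso X x y"
  shows "vhom X x z = vhom X y z"
  using assms vhom_le_precomp[of X x y z] vhom_le_precomp[of X y x z]
  by (auto simp: viso_def intro: antisym)

lemma vhom_viso_right:
  assumes "vcategory X" "x \<in> vobj X" "y \<in> vobj X" "z \<in> vobj X" "viso X x y"
  shows "vhom X z x = vhom X z y"
  using assms vhom_le_postcomp[of X z x y] vhom_le_postcomp[of X z y x]
  by (auto simp: viso_def intro: antisym)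

lemma viso_if_vhom_eq:
  assumes "vcategory X" "x \<in> vobj X" "y \<in> vobj X"
    and "\<And>z. z \<in> vobj X \<Longrightarrow> vhom X x z = vhom X y z"
  shows "viso X x y"
  using assms vcategory_refl[of X x] vcategory_refl[of X y] assms(4)[of x] assms(4)[of y]
  by (simp add: viso_def vle_def)

text \<open>
  The meet is attained at \<open>z = w\<close>, where the identity \<open>1 \<le> X(w,w)\<close> makes the implication at
  most \<open>X(v,w)\<close>; composition bounds it from below.
\<close>

lemma yoneda_covariant:
  assumes "vcategory X" "v \<in> vobj X" "w \<in> vobj X"
  shows "(INF z\<in>vobj X. qimp (vhom X w z) (vhom X v z)) = vhom X v w"
proof (rule antisym)
  have "(INF z\<in>vobj X. qimp (vhom X w z) (vhom X v z)) \<le> qimp (vhom X w w) (vhom X v w)"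
    using assms by (intro INF_lower)
  also have "\<dots> \<le> vhom X v w" using assms by (intro qimp_le_of_one_le vcategory_refl)
  finally show "(INF z\<in>vobj X. qimp (vhom X w z) (vhom X v z)) \<le> vhom X v w" .
  show "vhom X v w \<le> (INF z\<in>vobj X. qimp (vhom X w z) (vhom X v z))"
    using assms by (auto simp: le_INF_iff times_le_iff_le_qimp[symmetric] intro: vcategory_comp)
qed

lemma yoneda_contravariant:
  assumes "vcategory X" "v \<in> vobj X" "w \<in> vobj X"
  shows "(INF z\<in>vobj X. qimp (vhom X z w) (vhom X z v)) = vhom X w v"
  using yoneda_covariant[OF vcategory_vop[OF assms(1)], of v w] assms by simp

section \<open>Weighted limits and colimits\<close>

text \<open>
  Weights live on a bare index set. Suprema of presheaves, joins in the underlying preorder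
  (constant weight \<open>1\<close>) and the pushed-forward presheaves in the definition of density are all
  special cases.
\<close>

definition is_wcolim ::
  "('a, 'v::comm_quantale) vcat \<Rightarrow> 'i set \<Rightarrow> ('i \<Rightarrow> 'v) \<Rightarrow> ('i \<Rightarrow> 'a) \<Rightarrow> 'a \<Rightarrow> bool" where
  "is_wcolim X I w f s \<longleftrightarrow>
     s \<in> vobj X \<and> (\<forall>x\<in>vobj X. vhom X s x = (INF i\<in>I. qimp (w i) (vhom X (f i) x)))"

definition is_wlim ::
  "('a, 'v::comm_quantale) vcat \<Rightarrow> 'i set \<Rightarrow> ('i \<Rightarrow> 'v) \<Rightarrow> ('i \<Rightarrow> 'a) \<Rightarrow> 'a \<Rightarrow> bool" where
  "is_wlim X I w f l \<longleftrightarrow>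
     l \<in> vobj X \<and> (\<forall>x\<in>vobj X. vhom X x l = (INF i\<in>I. qimp (w i) (vhom X x (f i))))"

lemma is_wcolim_vop: "is_wcolim (vop X) = is_wlim X"
  by (simp add: is_wcolim_def is_wlim_def fun_eq_iff)

text \<open>
  The Yoneda lemma collapses the quantification over all objects \<open>y\<close> to the objects \<open>f i\<close>.
\<close>

lemma is_vsup_pushforward_iff:
  assumes "vcategory X" "f \<in> I \<rightarrow> vobj X"
  shows "is_vsup X (\<lambda>y. SUP i\<in>I. vhom X y (f i) * w i) s \<longleftrightarrow> is_wcolim X I w f s"
proof -
  have "(INF y\<in>vobj X. qimp (SUP i\<in>I. vhom X y (f i) * w i) (vhom X y x)) =
        (INF i\<in>I. qimp (w i) (vhom X (f i) x))" if "x \<in> vobj X" for x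
    unfolding INF_SUP_qimp_swap using assms that
    by (intro INF_cong refl arg_cong[where f = "qimp _"] yoneda_contravariant) auto
  then show ?thesis by (simp add: is_vsup_def is_wcolim_def)
qed

lemma is_vinf_eq_is_wlim: "is_vinf X w = is_wlim X (vobj X) w (\<lambda>x. x)"
  by (simp add: is_vinf_def is_wlim_def fun_eq_iff)

lemma is_vinf_eq_is_vsup_vop: "is_vinf X = is_vsup (vop X)"
  by (simp add: is_vinf_def is_vsup_def fun_eq_iff)

lemma is_vinf_pushforward_iff:
  assumes "vcategory X" "f \<in> I \<rightarrow> vobj X"
  shows "is_vinf X (\<lambda>y. SUP i\<in>I. vhom X (f i) y * w i) s \<longleftrightarrow> is_wlim X I w f s"
  using is_vsup_pushforward_iff[of "vop X" f I w s] assms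
  by (simp add: vcategory_vop is_vinf_eq_is_vsup_vop is_wcolim_vop)

lemma vfunctor_vbase_iff:
  "vfunctor X vbase \<phi> \<longleftrightarrow>
     (\<forall>x\<in>vobj X. \<forall>y\<in>vobj X. vhom X x y * \<phi> x \<le> (\<phi> y :: 'v::comm_quantale))"
  by (simp add: vfunctor_def times_le_iff_le_qimp)

lemma vcomplete_has_vinf:
  assumes "vcomplete X" "vfunctor X vbase \<phi>"
  shows "\<exists>l. is_vinf X \<phi> l"
proof -
  have "restrict \<phi> (vobj X) \<in> vobj (vfun_cat X vbase)"
    using assms(2) by (simp add: vfun_cat_def vfunctor_vbase_iff)
  then obtain l where "is_vinf X (restrict \<phi> (vobj X)) l"
    using assms(1) by (auto simp: vcomplete_def)
  then show ?thesis by (auto simp: is_vinf_def)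
qed

text \<open>
  The weight is pushed forward along \<open>f\<close> to a copresheaf, which completeness applies to.
\<close>

lemma vcomplete_has_wlim:
  assumes "vcategory X" "vcomplete X" "f \<in> I \<rightarrow> vobj X"
  shows "\<exists>l. is_wlim X I w f l"
proof -
  have "vfunctor X vbase (\<lambda>y. SUP i\<in>I. vhom X (f i) y * w i)"
    unfolding vfunctor_vbase_iff
  proof (intro ballI)
    fix x y assume xy: "x \<in> vobj X" "y \<in> vobj X"
    have "vhom X x y * (SUP i\<in>I. vhom X (f i) x * w i) =
          (SUP i\<in>I. vhom X (f i) x * vhom X x y * w i)"
      by (simp add: times_Sup_distrib image_image ac_simps)
    also have "\<dots> \<le> (SUP i\<in>I. vhom X (f i) y * w i)"
      using assms xy by (intro SUP_subset_mono order_refl quantale_mult_mono vcategory_comp) auto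
    finally show "vhom X x y * (SUP i\<in>I. vhom X (f i) x * w i) \<le> (SUP i\<in>I. vhom X (f i) y * w i)" .
  qed
  then show ?thesis
    using vcomplete_has_vinf[OF assms(2)] is_vinf_pushforward_iff[OF assms(1,3)] by blast
qed

text \<open>
  The familiar construction of suprema from infima: the colimit is the infimum of its own weighted
  cocones \<open>\<phi> x\<close>, the degree to which \<open>x\<close> is an upper bound of the weighted family.
\<close>

lemma vcomplete_has_wcolim:
  assumes "vcategory X" "vcomplete X" "f \<in> I \<rightarrow> vobj X"
  shows "\<exists>s. is_wcolim X I w f s"
proof -
  define \<phi> where "\<phi> = (\<lambda>x. INF i\<in>I. qimp (w i) (vhom X (f i) x))"
  obtain s where "is_vinf X \<phi> s"
  proof -
    have "vfunctor X vbase \<phi>" unfolding vfunctor_vbase_iff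
    proof (intro ballI)
      fix x y assume xy: "x \<in> vobj X" "y \<in> vobj X"
      have "vhom X x y * \<phi> x * w i \<le> vhom X (f i) y" if "i \<in> I" for i
      proof -
        have "\<phi> x \<le> qimp (w i) (vhom X (f i) x)" unfolding \<phi>_def using that by (rule INF_lower)
        then have "(\<phi> x * w i) * vhom X x y \<le> vhom X (f i) x * vhom X x y"
          by (intro quantale_mult_mono) (auto simp: times_le_iff_le_qimp)
        also have "\<dots> \<le> vhom X (f i) y" using assms xy that by (auto intro!: vcategory_comp)
        finally show ?thesis by (simp add: ac_simps)
      qed
      then show "vhom X x y * \<phi> x \<le> \<phi> y"
        by (simp add: \<phi>_def le_INF_iff times_le_iff_le_qimp)
    qed
    then show ?thesis using vcomplete_has_vinf[OF assms(2)] that by blast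
  qed
  then have s: "s \<in> vobj X" and hom_s:
    "\<And>x. x \<in> vobj X \<Longrightarrow> vhom X x s = (INF y\<in>vobj X. qimp (\<phi> y) (vhom X x y))"
    by (auto simp: is_vinf_def)
  have "vhom X s x = \<phi> x" if x: "x \<in> vobj X" for x
  proof (rule antisym)
    \<comment> \<open>each \<open>f i\<close> is a lower bound of \<open>\<phi>\<close> to the degree \<open>w i\<close>, hence maps into the infimum\<close>
    have "vhom X s x * w i \<le> vhom X (f i) x" if i: "i \<in> I" for i
    proof -
      have "w i \<le> qimp (\<phi> y) (vhom X (f i) y)" for y
      proof -
        have "\<phi> y \<le> qimp (w i) (vhom X (f i) y)" unfolding \<phi>_def using i by (rule INF_lower)
        then show ?thesis by (simp add: times_le_iff_le_qimp[symmetric] mult.commute)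
      qed
      then have "w i \<le> vhom X (f i) s"
        using assms i by (subst hom_s) (auto simp: le_INF_iff)
      then have "w i * vhom X s x \<le> vhom X (f i) s * vhom X s x"
        by (intro quantale_mult_mono) auto
      also have "\<dots> \<le> vhom X (f i) x" using assms i s x by (auto intro!: vcategory_comp)
      finally show ?thesis by (simp add: mult.commute)
    qed
    then show "vhom X s x \<le> \<phi> x" by (simp add: \<phi>_def le_INF_iff times_le_iff_le_qimp)
    \<comment> \<open>the infimum lies below every weighted upper bound\<close>
    have "1 \<le> vhom X s s" using assms(1) s by (rule vcategory_refl)
    then show "\<phi> x \<le> vhom X s x"
      using x s by (simp add: hom_s[of s] le_INF_iff one_le_qimp_iff)
  qed
  then show ?thesis using s by (auto simp: is_wcolim_def \<phi>_def)
qed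

text \<open>
  A join in the underlying preorder need not satisfy the enriched formula for homs out of it. The
  colimit with constant weight \<open>1\<close> does, it is a join, and any two joins are isomorphic, so the
  join chosen by \<open>vjoin\<close> inherits the formula.
\<close>

lemma vjoin_vhom:
  assumes cat: "vcategory X" and f: "f \<in> I \<rightarrow> vobj X"
    and ex: "\<exists>s. is_wcolim X I (\<lambda>_. 1) f s"
  shows "vjoin X (f ` I) \<in> vobj X"
    and "x \<in> vobj X \<Longrightarrow> vhom X (vjoin X (f ` I)) x = (INF i\<in>I. vhom X (f i) x)"
proof -
  obtain s where s: "s \<in> vobj X" "\<And>x. x \<in> vobj X \<Longrightarrow> vhom X s x = (INF i\<in>I. vhom X (f i) x)"
    using ex by (auto simp: is_wcolim_def)
  have s_join: "is_vjoin X (f ` I) s"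
    using vcategory_refl[OF cat s(1)] s by (auto simp: is_vjoin_def vle_def le_INF_iff)
  then have j: "is_vjoin X (f ` I) (vjoin X (f ` I))"
    unfolding vjoin_def by (rule someI)
  then show obj: "vjoin X (f ` I) \<in> vobj X" by (simp add: is_vjoin_def)
  have "viso X (vjoin X (f ` I)) s"
    using j s_join by (auto simp: is_vjoin_def viso_def)
  then show "vhom X (vjoin X (f ` I)) x = (INF i\<in>I. vhom X (f i) x)" if "x \<in> vobj X"
    using vhom_viso_left[OF cat obj s(1) that] s(2)[OF that] by simp
qed

lemma vmeet_eq_vjoin_vop: "vmeet X = vjoin (vop X)"
  by (simp add: vmeet_def vjoin_def is_vmeet_def is_vjoin_def vle_def fun_eq_iff)

lemma vmeet_vhom:
  assumes "vcategory X" and "f \<in> I \<rightarrow> vobj X"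
    and "\<exists>s. is_wlim X I (\<lambda>_. 1) f s"
  shows "vmeet X (f ` I) \<in> vobj X"
    and "x \<in> vobj X \<Longrightarrow> vhom X x (vmeet X (f ` I)) = (INF i\<in>I. vhom X x (f i))"
  using vjoin_vhom[OF vcategory_vop[OF assms(1)], of f I] assms
  by (simp_all add: vmeet_eq_vjoin_vop is_wcolim_vop)

section \<open>Density\<close>

text \<open>
  If \<open>c\<close> is a colimit of \<open>f\<close> with any weight \<open>\<mu>\<close>, then \<open>\<mu> d \<le> X(f d, c)\<close> by the unit of the
  colimit, so enlarging \<open>\<mu>\<close> to \<open>X(f -, c)\<close> only decreases the meet that defines a colimit; composition
  shows that it does not fall below \<open>X(c, x)\<close>. Hence the canonical weight may replace the
  existentially quantified one.
\<close>

lemma vdense_iff: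
  assumes cat: "vcategory X" and f: "vfunctor D X f"
  shows "vdense D X f \<longleftrightarrow>
    (\<forall>c\<in>vobj X. is_wcolim X (vobj D) (\<lambda>d. vhom X (f d) c) f c)"
proof -
  have fo: "f \<in> vobj D \<rightarrow> vobj X" using f by (simp add: vfunctor_def)
  note push = is_vsup_pushforward_iff[OF cat fo]
  show ?thesis
  proof
    assume dense: "vdense D X f"
    show "\<forall>c\<in>vobj X. is_wcolim X (vobj D) (\<lambda>d. vhom X (f d) c) f c"
    proof
      fix c assume c: "c \<in> vobj X"
      then obtain \<mu> where colim: "is_wcolim X (vobj D) \<mu> f c"
        using dense by (auto simp: vdense_def push)
      have "vhom X c x = (INF d\<in>vobj D. qimp (vhom X (f d) c) (vhom X (f d) x))"
        if x: "x \<in> vobj X" for x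
      proof (rule antisym)
        show "vhom X c x \<le> (INF d\<in>vobj D. qimp (vhom X (f d) c) (vhom X (f d) x))"
          using vcategory_comp[OF cat _ c x] fo
          by (auto simp: le_INF_iff times_le_iff_le_qimp[symmetric] mult.commute[of "vhom X c x"])
        have "\<mu> d \<le> vhom X (f d) c" if "d \<in> vobj D" for d
        proof -
          have "1 \<le> vhom X c c" using cat c by (rule vcategory_refl)
          then show ?thesis using colim c that
            by (simp add: is_wcolim_def le_INF_iff one_le_qimp_iff)
        qed
        then have "(INF d\<in>vobj D. qimp (vhom X (f d) c) (vhom X (f d) x)) \<le>
              (INF d\<in>vobj D. qimp (\<mu> d) (vhom X (f d) x))"
          by (intro INF_superset_mono order_refl qimp_antitone)
        also have "\<dots> = vhom X c x" using colim x by (simp add: is_wcolim_def)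
        finally show "(INF d\<in>vobj D. qimp (vhom X (f d) c) (vhom X (f d) x)) \<le> vhom X c x" .
      qed
      then show "is_wcolim X (vobj D) (\<lambda>d. vhom X (f d) c) f c"
        using c by (simp add: is_wcolim_def)
    qed
  next
    assume colim: "\<forall>c\<in>vobj X. is_wcolim X (vobj D) (\<lambda>d. vhom X (f d) c) f c"
    show "vdense D X f" unfolding vdense_def push
    proof
      fix c assume c: "c \<in> vobj X"
      define \<mu> where "\<mu> = (\<lambda>d\<in>vobj D. vhom X (f d) c)"
      have "vhom D e d * vhom X (f d) c \<le> vhom X (f e) c" if "d \<in> vobj D" "e \<in> vobj D" for d e
      proof -
        have "vhom D e d * vhom X (f d) c \<le> vhom X (f e) (f d) * vhom X (f d) c"
          using f that by (intro quantale_mult_mono) (auto intro: vfunctor_hom)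
        also have "\<dots> \<le> vhom X (f e) c" using cat fo c that by (auto intro!: vcategory_comp)
        finally show ?thesis .
      qed
      then have "\<mu> \<in> vobj (vfun_cat (vop D) vbase)"
        by (simp add: vfun_cat_def vfunctor_vbase_iff \<mu>_def)
      moreover have "is_wcolim X (vobj D) \<mu> f c"
        using colim c by (simp add: is_wcolim_def \<mu>_def)
      ultimately show "\<exists>\<mu>\<in>vobj (vfun_cat (vop D) vbase). is_wcolim X (vobj D) \<mu> f c" by blast
    qed
  qed
qed

lemma vcodense_eq_vdense_vop: "vcodense D X f = vdense (vop D) (vop X) f"
  by (simp add: vdense_def vcodense_def is_vinf_eq_is_vsup_vop)

lemma vcodense_iff:
  assumes "vcategory X" "vfunctor D X f"
  shows "vcodense D X f \<longleftrightarrow>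
    (\<forall>c\<in>vobj X. is_wlim X (vobj D) (\<lambda>d. vhom X c (f d)) f c)"
  using vdense_iff[of "vop X" "vop D" f] assms
  by (simp add: vcodense_eq_vdense_vop vfunctor_vop vcategory_vop is_wcolim_vop)

section \<open>Equivalences\<close>

text \<open>
  An equivalence consists of fully faithful functors that are adjoint to each other on both sides.
  The hom formulas, rather than the natural isomorphisms, are what transports structure.
\<close>

lemma vequivalentE:
  assumes "vcategory C" "vcategory D" "vequivalent C D"
  obtains f g where "vfunctor C D f" "vfunctor D C g"
    "\<And>c c'. c \<in> vobj C \<Longrightarrow> c' \<in> vobj C \<Longrightarrow> vhom D (f c) (f c') = vhom C c c'"
    "\<And>c d. c \<in> vobj C \<Longrightarrow> d \<in> vobj D \<Longrightarrow> vhom D (f c) d = vhom C c (g d)"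
    "\<And>c d. c \<in> vobj C \<Longrightarrow> d \<in> vobj D \<Longrightarrow> vhom D d (f c) = vhom C (g d) c"
    "\<And>d d'. d \<in> vobj D \<Longrightarrow> d' \<in> vobj D \<Longrightarrow> vhom C (g d) (g d') = vhom D d d'"
proof -
  obtain f g where f: "vfunctor C D f" and g: "vfunctor D C g"
    and gf: "\<And>c. c \<in> vobj C \<Longrightarrow> viso C (g (f c)) c"
    and fg: "\<And>d. d \<in> vobj D \<Longrightarrow> viso D (f (g d)) d"
    using assms(3) by (auto simp: vequivalent_def vfun_iso_def vfun_le_def viso_def)
  have fo: "f c \<in> vobj D" if "c \<in> vobj C" for c using f that by (rule vfunctor_obj)
  have go: "g d \<in> vobj C" if "d \<in> vobj D" for d using g that by (rule vfunctor_obj)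
  have ff: "vhom D (f c) (f c') = vhom C c c'" if "c \<in> vobj C" "c' \<in> vobj C" for c c'
  proof (rule antisym)
    have "vhom D (f c) (f c') \<le> vhom C (g (f c)) (g (f c'))"
      using g that fo by (intro vfunctor_hom)
    also have "\<dots> = vhom C c (g (f c'))"
      using assms(1) that fo go gf by (intro vhom_viso_left) auto
    also have "\<dots> = vhom C c c'"
      using assms(1) that fo go gf by (intro vhom_viso_right) auto
    finally show "vhom D (f c) (f c') \<le> vhom C c c'" .
    show "vhom C c c' \<le> vhom D (f c) (f c')" using f that by (intro vfunctor_hom)
  qed
  have "vhom D (f c) d = vhom C c (g d)" if "c \<in> vobj C" "d \<in> vobj D" for c d
    using ff[of c "g d"] vhom_viso_right[OF assms(2) _ _ _ fg, of d "f c"] that fo go by simp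
  moreover have "vhom D d (f c) = vhom C (g d) c" if "c \<in> vobj C" "d \<in> vobj D" for c d
    using ff[of "g d" c] vhom_viso_left[OF assms(2) _ _ _ fg, of d "f c"] that fo go by simp
  moreover have "vhom C (g d) (g d') = vhom D d d'" if "d \<in> vobj D" "d' \<in> vobj D" for d d'
    using ff[of "g d" "g d'"] vhom_viso_left[OF assms(2) _ _ _ fg, of d "f (g d')"]
      vhom_viso_right[OF assms(2) _ _ _ fg, of d' d] that fo go by simp
  ultimately show thesis using that f g ff by blast
qed

lemma vequivalentI:
  assumes C: "vcategory C" and D: "vcategory D"
    and fo: "\<And>c. c \<in> vobj C \<Longrightarrow> f c \<in> vobj D"
    and ff: "\<And>c c'. c \<in> vobj C \<Longrightarrow> c' \<in> vobj C \<Longrightarrow> vhom D (f c) (f c') = vhom C c c'"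
    and surj: "\<And>d. d \<in> vobj D \<Longrightarrow> \<exists>c\<in>vobj C. viso D (f c) d"
  shows "vequivalent C D"
proof -
  obtain g where go: "\<And>d. d \<in> vobj D \<Longrightarrow> g d \<in> vobj C"
    and fg: "\<And>d. d \<in> vobj D \<Longrightarrow> viso D (f (g d)) d"
    using surj by metis
  have "vfunctor C D f" using fo ff by (auto simp: vfunctor_def)
  moreover have "vhom C (g d) (g e) = vhom D d e" if "d \<in> vobj D" "e \<in> vobj D" for d e
  proof -
    have "vhom C (g d) (g e) = vhom D (f (g d)) (f (g e))" using ff go that by simp
    also have "\<dots> = vhom D d (f (g e))"
      using D that fo go fg by (intro vhom_viso_left) auto
    also have "\<dots> = vhom D d e"
      using D that fo go fg by (intro vhom_viso_right) auto
    finally show ?thesis .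
  qed
  then have "vfunctor D C g" using go by (auto simp: vfunctor_def)
  moreover have "viso C (g (f c)) c" if "c \<in> vobj C" for c
    using fg[of "f c"] that fo go ff[of "g (f c)" c] ff[of c "g (f c)"]
    by (simp add: viso_def vle_def)
  ultimately show ?thesis unfolding vequivalent_def vfun_iso_def vfun_le_def
    using fg by (intro exI[of _ f] exI[of _ g]) (auto simp: viso_def)
qed

lemma vfunctor_comp:
  assumes "vfunctor D K h" "vfunctor K C g"
  shows "vfunctor D C (g \<circ> h)"
  unfolding vfunctor_def
proof (intro conjI ballI)
  show "g \<circ> h \<in> vobj D \<rightarrow> vobj C" using assms by (auto simp: vfunctor_def)
  fix x y assume xy: "x \<in> vobj D" "y \<in> vobj D"
  have "vhom D x y \<le> vhom K (h x) (h y)" using assms(1) xy by (rule vfunctor_hom)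
  also have "\<dots> \<le> vhom C (g (h x)) (g (h y))"
    using assms xy by (intro vfunctor_hom) (auto intro: vfunctor_obj)
  finally show "vhom D x y \<le> vhom C ((g \<circ> h) x) ((g \<circ> h) y)" by simp
qed

text \<open>
  By the adjunction, the weights \<open>C(g (h d), c)\<close> and \<open>K(h d, f c)\<close> agree, so the density formula in
  \<open>K\<close> at the objects \<open>f c\<close> and \<open>f x\<close> is the one in \<open>C\<close> at \<open>c\<close> and \<open>x\<close>.
\<close>

lemma vdense_transport:
  assumes cats: "vcategory C" "vcategory K" and h: "vfunctor D K h" and g: "vfunctor K C g"
    and f: "\<And>c. c \<in> vobj C \<Longrightarrow> f c \<in> vobj K"
    and ff: "\<And>c c'. c \<in> vobj C \<Longrightarrow> c' \<in> vobj C \<Longrightarrow> vhom K (f c) (f c') = vhom C c c'"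
    and adj: "\<And>c k. c \<in> vobj C \<Longrightarrow> k \<in> vobj K \<Longrightarrow> vhom K k (f c) = vhom C (g k) c"
    and dense: "vdense D K h"
  shows "vdense D C (g \<circ> h)"
proof -
  have adj_h: "vhom C (g (h d)) c = vhom K (h d) (f c)" if "d \<in> vobj D" "c \<in> vobj C" for d c
    using adj that vfunctor_obj[OF h] by simp
  have colim: "\<And>k. k \<in> vobj K \<Longrightarrow> is_wcolim K (vobj D) (\<lambda>d. vhom K (h d) k) h k"
    using dense vdense_iff[OF cats(2) h] by blast
  have "vhom C c x = (INF d\<in>vobj D. qimp (vhom C (g (h d)) c) (vhom C (g (h d)) x))"
    if c: "c \<in> vobj C" and x: "x \<in> vobj C" for c x
    using colim[OF f[OF c]] f[OF x] ff[OF c x] c x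
    by (simp add: is_wcolim_def adj_h cong: INF_cong)
  then show ?thesis
    by (simp add: vdense_iff[OF cats(1) vfunctor_comp[OF h g]] is_wcolim_def)
qed

lemma vcodense_transport:
  assumes "vcategory C" "vcategory K" "vfunctor D K h" "vfunctor K C g"
    and "\<And>c. c \<in> vobj C \<Longrightarrow> f c \<in> vobj K"
    and "\<And>c c'. c \<in> vobj C \<Longrightarrow> c' \<in> vobj C \<Longrightarrow> vhom K (f c) (f c') = vhom C c c'"
    and "\<And>c k. c \<in> vobj C \<Longrightarrow> k \<in> vobj K \<Longrightarrow> vhom K (f c) k = vhom C c (g k)"
    and "vcodense D K h"
  shows "vcodense D C (g \<circ> h)"
  unfolding vcodense_eq_vdense_vop
  by (rule vdense_transport[where K = "vop K" and f = f])
    (use assms in \<open>auto simp: vcategory_vop vfunctor_vop vcodense_eq_vdense_vop\<close>)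

section \<open>Fixed points of the adjunction induced by a bifunctor\<close>

locale adjunction_kernel =
  fixes X :: "('x, 'v::comm_quantale) vcat"
    and Y :: "('y, 'v) vcat"
    and Z :: "('z, 'v) vcat"
    and A :: "('a, 'v) vcat"
    and B :: "('b, 'v) vcat"
    and ostar :: "'x \<times> 'y \<Rightarrow> 'z"
    and sw :: "'z \<times> 'y \<Rightarrow> 'x"
    and se :: "'x \<times> 'z \<Rightarrow> 'y"
    and \<zeta> :: "'a \<times> 'b \<Rightarrow> 'x"
  assumes cat_Y: "vcategory Y" and complete_Y: "vcomplete Y"
    and cat_Z: "vcategory Z" and complete_Z: "vcomplete Z"
    and adjunction: "two_variable_adjunction X Y Z ostar sw se"
    and cat_A: "vcategory A" and cat_B: "vcategory B"
    and zeta: "vfunctor (vtensor (vop A) B) X \<zeta>"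
begin

abbreviation "lo \<equiv> lower_dagger A B Y se \<zeta>"
abbreviation "up \<equiv> upper_dagger A B Z ostar \<zeta>"
abbreviation "K \<equiv> K_dagger A B Y Z ostar se \<zeta>"

lemma zeta_obj: "a \<in> vobj A \<Longrightarrow> b \<in> vobj B \<Longrightarrow> \<zeta> (a, b) \<in> vobj X"
  using vfunctor_obj[OF zeta] by simp

lemma ostar_obj: "x \<in> vobj X \<Longrightarrow> y \<in> vobj Y \<Longrightarrow> ostar (x, y) \<in> vobj Z"
  using adjunction vfunctor_obj[of "vtensor X Y" Z ostar] by (simp add: two_variable_adjunction_def)

lemma se_obj: "x \<in> vobj X \<Longrightarrow> z \<in> vobj Z \<Longrightarrow> se (x, z) \<in> vobj Y"
  using adjunction vfunctor_obj[of "vtensor (vop X) Z" Y se]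
  by (simp add: two_variable_adjunction_def)

lemma transpose:
  assumes "x \<in> vobj X" "y \<in> vobj Y" "z \<in> vobj Z"
  shows "vhom Z (ostar (x, y)) z = vhom Y y (se (x, z))"
    and "vhom X x (sw (z, y)) = vhom Y y (se (x, z))"
  using adjunction assms by (simp_all add: two_variable_adjunction_def)

lemma ostar_hom:
  assumes "x \<in> vobj X" "x' \<in> vobj X" "y \<in> vobj Y" "y' \<in> vobj Y"
  shows "vhom X x x' * vhom Y y y' \<le> vhom Z (ostar (x, y)) (ostar (x', y'))"
  using adjunction vfunctor_hom[of "vtensor X Y" Z ostar "(x, y)" "(x', y')"] assms
  by (simp add: two_variable_adjunction_def)

lemma zeta_hom_left:
  assumes "a \<in> vobj A" "a' \<in> vobj A" "b \<in> vobj B"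
  shows "vhom A a a' \<le> vhom X (\<zeta> (a', b)) (\<zeta> (a, b))"
proof -
  have "vhom A a a' * 1 \<le> vhom A a a' * vhom B b b"
    using cat_B assms by (intro quantale_mult_mono order_refl vcategory_refl)
  also have "\<dots> \<le> vhom X (\<zeta> (a', b)) (\<zeta> (a, b))"
    using vfunctor_hom[OF zeta, of "(a', b)" "(a, b)"] assms by simp
  finally show ?thesis by simp
qed

lemma zeta_hom_right:
  assumes "a \<in> vobj A" "b \<in> vobj B" "b' \<in> vobj B"
  shows "vhom B b b' \<le> vhom X (\<zeta> (a, b)) (\<zeta> (a, b'))"
proof -
  have "1 * vhom B b b' \<le> vhom A a a * vhom B b b'"
    using cat_A assms by (intro quantale_mult_mono order_refl vcategory_refl)
  also have "\<dots> \<le> vhom X (\<zeta> (a, b)) (\<zeta> (a, b'))"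
    using vfunctor_hom[OF zeta, of "(a, b)" "(a, b')"] assms by simp
  finally show ?thesis by simp
qed

text \<open>
  Homs out of \<open>up \<mu> b\<close> are written with \<open>\<searrow>\<close> instead of \<open>\<circledast>\<close>. Homs into \<open>lo \<kappa> a\<close> then have
  the same form, which reduces the Galois connection to an exchange of meets.
\<close>

lemma up_obj: "\<mu> \<in> vobj A \<rightarrow> vobj Y \<Longrightarrow> b \<in> vobj B \<Longrightarrow> up \<mu> b \<in> vobj Z"
  and up_hom: "\<mu> \<in> vobj A \<rightarrow> vobj Y \<Longrightarrow> b \<in> vobj B \<Longrightarrow> z \<in> vobj Z \<Longrightarrow>
    vhom Z (up \<mu> b) z = (INF a\<in>vobj A. vhom Y (\<mu> a) (se (\<zeta> (a, b), z)))"
proof -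
  assume \<mu>: "\<mu> \<in> vobj A \<rightarrow> vobj Y" and b: "b \<in> vobj B"
  define f where "f = (\<lambda>a. ostar (\<zeta> (a, b), \<mu> a))"
  have f: "f \<in> vobj A \<rightarrow> vobj Z" using \<mu> b by (auto simp: f_def intro!: ostar_obj zeta_obj)
  have up: "up \<mu> b = vjoin Z (f ` vobj A)" using b by (simp add: upper_dagger_def f_def)
  note join = vjoin_vhom[OF cat_Z f vcomplete_has_wcolim[OF cat_Z complete_Z f]]
  show "up \<mu> b \<in> vobj Z" unfolding up by (rule join(1))
  assume z: "z \<in> vobj Z"
  show "vhom Z (up \<mu> b) z = (INF a\<in>vobj A. vhom Y (\<mu> a) (se (\<zeta> (a, b), z)))"
    unfolding up join(2)[OF z] unfolding f_def
    using \<mu> b z by (intro INF_cong refl transpose zeta_obj) auto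
qed

lemma lo_obj: "\<kappa> \<in> vobj B \<rightarrow> vobj Z \<Longrightarrow> a \<in> vobj A \<Longrightarrow> lo \<kappa> a \<in> vobj Y"
  and lo_hom: "\<kappa> \<in> vobj B \<rightarrow> vobj Z \<Longrightarrow> a \<in> vobj A \<Longrightarrow> y \<in> vobj Y \<Longrightarrow>
    vhom Y y (lo \<kappa> a) = (INF b\<in>vobj B. vhom Y y (se (\<zeta> (a, b), \<kappa> b)))"
proof -
  assume \<kappa>: "\<kappa> \<in> vobj B \<rightarrow> vobj Z" and a: "a \<in> vobj A"
  define f where "f = (\<lambda>b. se (\<zeta> (a, b), \<kappa> b))"
  have f: "f \<in> vobj B \<rightarrow> vobj Y" using \<kappa> a by (auto simp: f_def intro!: se_obj zeta_obj)
  have lo: "lo \<kappa> a = vmeet Y (f ` vobj B)" using a by (simp add: lower_dagger_def f_def)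
  note meet = vmeet_vhom[OF cat_Y f vcomplete_has_wlim[OF cat_Y complete_Y f]]
  show "lo \<kappa> a \<in> vobj Y" unfolding lo by (rule meet(1))
  assume y: "y \<in> vobj Y"
  show "vhom Y y (lo \<kappa> a) = (INF b\<in>vobj B. vhom Y y (se (\<zeta> (a, b), \<kappa> b)))"
    unfolding lo meet(2)[OF y] by (simp add: f_def)
qed

lemma up_lo_adjunction:
  assumes "\<kappa> \<in> vobj B \<rightarrow> vobj Z" "\<mu> \<in> vobj A \<rightarrow> vobj Y"
  shows "(INF b\<in>vobj B. vhom Z (up \<mu> b) (\<kappa> b)) = (INF a\<in>vobj A. vhom Y (\<mu> a) (lo \<kappa> a))"
proof -
  have "(INF b\<in>vobj B. vhom Z (up \<mu> b) (\<kappa> b)) =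
        (INF b\<in>vobj B. INF a\<in>vobj A. vhom Y (\<mu> a) (se (\<zeta> (a, b), \<kappa> b)))"
    using assms by (intro INF_cong refl up_hom) auto
  also have "\<dots> = (INF a\<in>vobj A. INF b\<in>vobj B. vhom Y (\<mu> a) (se (\<zeta> (a, b), \<kappa> b)))"
    by (rule INF_commute)
  also have "\<dots> = (INF a\<in>vobj A. vhom Y (\<mu> a) (lo \<kappa> a))"
    using assms by (intro INF_cong refl lo_hom[symmetric]) auto
  finally show ?thesis .
qed

lemma lo_fun: "\<kappa> \<in> vobj B \<rightarrow> vobj Z \<Longrightarrow> lo \<kappa> \<in> vobj A \<rightarrow> vobj Y"
  and up_fun: "\<mu> \<in> vobj A \<rightarrow> vobj Y \<Longrightarrow> up \<mu> \<in> vobj B \<rightarrow> vobj Z"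
  by (auto intro: lo_obj up_obj)

lemma up_lo_le:
  assumes "\<kappa> \<in> vobj B \<rightarrow> vobj Z" "b \<in> vobj B"
  shows "vle Z (up (lo \<kappa>) b) (\<kappa> b)"
proof -
  have "1 \<le> (INF a\<in>vobj A. vhom Y (lo \<kappa> a) (lo \<kappa> a))"
    using assms by (auto simp: le_INF_iff intro!: vcategory_refl[OF cat_Y] lo_obj)
  then show ?thesis using assms(2)
    by (simp add: up_lo_adjunction[OF assms(1) lo_fun[OF assms(1)], symmetric] le_INF_iff vle_def)
qed

lemma le_lo_up:
  assumes "\<mu> \<in> vobj A \<rightarrow> vobj Y" "a \<in> vobj A"
  shows "vle Y (\<mu> a) (lo (up \<mu>) a)"
proof -
  have "1 \<le> (INF b\<in>vobj B. vhom Z (up \<mu> b) (up \<mu> b))"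
    using assms by (auto simp: le_INF_iff intro!: vcategory_refl[OF cat_Z] up_obj)
  then show ?thesis using up_lo_adjunction[OF up_fun[OF assms(1)] assms(1)] assms(2)
    by (simp add: le_INF_iff vle_def)
qed

lemma le_se_up:
  assumes "\<mu> \<in> vobj A \<rightarrow> vobj Y" "a \<in> vobj A" "b \<in> vobj B"
  shows "vle Y (\<mu> a) (se (\<zeta> (a, b), up \<mu> b))"
  using vcategory_refl[OF cat_Z up_obj[OF assms(1,3)]] assms
  by (simp add: up_hom up_obj le_INF_iff vle_def)

text \<open>
  Functoriality of \<open>up \<mu>\<close> comes from that of \<open>\<zeta>\<close> in its second argument:
  each member \<open>\<zeta>(a,b) \<circledast> \<mu> a\<close> of the join is functorial in \<open>b\<close>.
\<close>

lemma up_functor: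
  assumes \<mu>: "\<mu> \<in> vobj A \<rightarrow> vobj Y"
  shows "vfunctor B Z (up \<mu>)"
  unfolding vfunctor_def
proof (intro conjI ballI)
  show "up \<mu> \<in> vobj B \<rightarrow> vobj Z" using \<mu> by (rule up_fun)
  fix b b' assume b: "b \<in> vobj B" "b' \<in> vobj B"
  have "vhom B b b' \<le> vhom Y (\<mu> a) (se (\<zeta> (a, b), up \<mu> b'))" if a: "a \<in> vobj A" for a
  proof -
    have \<mu>a: "\<mu> a \<in> vobj Y" using \<mu> a by auto
    note objs = zeta_obj[OF a b(1)] zeta_obj[OF a b(2)] \<mu>a up_obj[OF \<mu> b(2)]
    have "vhom B b b' * 1 \<le> vhom X (\<zeta> (a, b)) (\<zeta> (a, b')) * vhom Y (\<mu> a) (\<mu> a)"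
      using a b \<mu>a by (intro quantale_mult_mono zeta_hom_right vcategory_refl[OF cat_Y])
    also have "\<dots> \<le> vhom Z (ostar (\<zeta> (a, b), \<mu> a)) (ostar (\<zeta> (a, b'), \<mu> a))"
      using objs by (intro ostar_hom)
    also have "\<dots> \<le> vhom Z (ostar (\<zeta> (a, b), \<mu> a)) (up \<mu> b')"
      using le_se_up[OF \<mu> a b(2)] objs
      by (intro vhom_le_postcomp[OF cat_Z]) (auto simp: vle_def transpose ostar_obj)
    finally show ?thesis using objs by (simp add: transpose)
  qed
  then show "vhom B b b' \<le> vhom Z (up \<mu> b) (up \<mu> b')"
    using \<mu> b by (simp add: up_hom up_obj le_INF_iff)
qed

text \<open>
  The other half of the isomorphism, \<open>up_lo_le\<close>, holds for every functor.
\<close>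

lemma K_obj_iff:
  "\<kappa> \<in> vobj K \<longleftrightarrow> \<kappa> \<in> extensional (vobj B) \<and> vfunctor B Z \<kappa> \<and>
     (\<forall>b\<in>vobj B. vle Z (\<kappa> b) (up (lo \<kappa>) b))"
proof -
  have "vle Z (up (lo \<kappa>) b) (\<kappa> b)" if "vfunctor B Z \<kappa>" "b \<in> vobj B" for b
    using that by (intro up_lo_le) (auto simp: vfunctor_def)
  then show ?thesis
    by (auto simp: K_dagger_def vfun_cat_def vfun_iso_def vfun_le_def)
qed

lemma K_hom: "vhom K \<kappa> \<kappa>' = (INF b\<in>vobj B. vhom Z (\<kappa>' b) (\<kappa> b))"
  by (simp add: K_dagger_def vfun_cat_def)

lemma K_fun: "\<kappa> \<in> vobj K \<Longrightarrow> \<kappa> \<in> vobj B \<rightarrow> vobj Z"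
  by (simp add: K_obj_iff vfunctor_def)

lemma K_viso:
  assumes "\<kappa> \<in> vobj K" "b \<in> vobj B"
  shows "viso Z (up (lo \<kappa>) b) (\<kappa> b)"
  using assms up_lo_le[OF K_fun[OF assms(1)] assms(2)] by (simp add: viso_def K_obj_iff)

text \<open>
  A fixed point may be replaced by \<open>up (lo \<kappa>)\<close>, so homs out of its values are determined by \<open>lo \<kappa>\<close>.
\<close>

lemma K_hom_out:
  assumes \<kappa>: "\<kappa> \<in> vobj K" and b: "b \<in> vobj B" and z: "z \<in> vobj Z"
  shows "vhom Z (\<kappa> b) z = (INF a\<in>vobj A. vhom Y (lo \<kappa> a) (se (\<zeta> (a, b), z)))"
proof -
  have "vhom Z (\<kappa> b) z = vhom Z (up (lo \<kappa>) b) z"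
    using K_fun[OF \<kappa>] b z by (intro vhom_viso_left[symmetric, OF cat_Z _ _ _ K_viso] up_obj lo_fun \<kappa>) auto
  then show ?thesis using K_fun[OF \<kappa>] b z by (simp add: up_hom lo_fun)
qed

text \<open>
  On fixed points \<open>lo\<close> is fully faithful, as the restriction of a Galois connection to its closed
  elements: replacing \<open>\<kappa>'\<close> by \<open>up (lo \<kappa>')\<close> exhibits the hom as one side of the connection.
\<close>

lemma K_hom_lo:
  assumes \<kappa>: "\<kappa> \<in> vobj B \<rightarrow> vobj Z" and \<kappa>': "\<kappa>' \<in> vobj K"
  shows "vhom K \<kappa> \<kappa>' = (INF a\<in>vobj A. vhom Y (lo \<kappa>' a) (lo \<kappa> a))"
proof -
  note \<kappa>'_fun = K_fun[OF \<kappa>']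
  have "vhom K \<kappa> \<kappa>' = (INF b\<in>vobj B. vhom Z (up (lo \<kappa>') b) (\<kappa> b))"
    unfolding K_hom
  proof (intro INF_cong refl)
    fix b assume b: "b \<in> vobj B"
    show "vhom Z (\<kappa>' b) (\<kappa> b) = vhom Z (up (lo \<kappa>') b) (\<kappa> b)"
      using K_hom_out[OF \<kappa>' b] \<kappa> b up_hom[OF lo_fun[OF \<kappa>'_fun] b] by (auto simp: Pi_iff)
  qed
  then show ?thesis using up_lo_adjunction[OF \<kappa> lo_fun[OF \<kappa>'_fun]] by simp
qed

lemma K_category: "vcategory K"
  unfolding vcategory_def
proof (intro conjI ballI)
  fix \<kappa> assume "\<kappa> \<in> vobj K"
  then show "1 \<le> vhom K \<kappa> \<kappa>"
    using K_fun by (auto simp: K_hom le_INF_iff intro!: vcategory_refl[OF cat_Z])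
next
  fix \<kappa> \<kappa>' \<kappa>'' assume \<kappa>: "\<kappa> \<in> vobj K" "\<kappa>' \<in> vobj K" "\<kappa>'' \<in> vobj K"
  have "vhom K \<kappa> \<kappa>' * vhom K \<kappa>' \<kappa>'' \<le> vhom Z (\<kappa>'' b) (\<kappa> b)" if b: "b \<in> vobj B" for b
  proof -
    have "vhom K \<kappa> \<kappa>' * vhom K \<kappa>' \<kappa>'' \<le> vhom Z (\<kappa>' b) (\<kappa> b) * vhom Z (\<kappa>'' b) (\<kappa>' b)"
      unfolding K_hom using b by (intro quantale_mult_mono INF_lower)
    also have "\<dots> \<le> vhom Z (\<kappa>'' b) (\<kappa> b)"
      using K_fun[OF \<kappa>(1)] K_fun[OF \<kappa>(2)] K_fun[OF \<kappa>(3)] b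
      by (subst mult.commute) (intro vcategory_comp[OF cat_Z]; auto)
    finally show ?thesis .
  qed
  then show "vhom K \<kappa> \<kappa>' * vhom K \<kappa>' \<kappa>'' \<le> vhom K \<kappa> \<kappa>''"
    by (simp add: K_hom[of \<kappa> \<kappa>''] le_INF_iff)
qed

text \<open>
  Applying the unit \<open>\<mu> \<le> lo (up \<mu>)\<close> twice gives \<open>\<mu> \<le> lo (up (lo (up \<mu>)))\<close>, whose transpose is
  the nontrivial half of \<open>up \<mu>\<close> being a fixed point.
\<close>

lemma up_in_K:
  assumes \<mu>: "\<mu> \<in> vobj A \<rightarrow> vobj Y"
  shows "up \<mu> \<in> vobj K"
proof -
  note fun1 = up_fun[OF \<mu>]
  note fun2 = lo_fun[OF fun1]
  note fun3 = up_fun[OF fun2]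
  have "1 \<le> vhom Y (\<mu> a) (lo (up (lo (up \<mu>))) a)" if a: "a \<in> vobj A" for a
    using vle_trans[OF cat_Y _ _ _ le_lo_up[OF \<mu> a] le_lo_up[OF fun2 a]]
      \<mu> fun2 lo_fun[OF fun3] a by (auto simp: vle_def)
  then have "1 \<le> (INF b\<in>vobj B. vhom Z (up \<mu> b) (up (lo (up \<mu>)) b))"
    by (simp add: up_lo_adjunction[OF fun3 \<mu>] le_INF_iff)
  then have "\<forall>b\<in>vobj B. vle Z (up \<mu> b) (up (lo (up \<mu>)) b)"
    by (simp add: le_INF_iff vle_def)
  then show ?thesis
    using up_functor[OF \<mu>] by (simp add: K_obj_iff upper_dagger_def)
qed

text \<open>
  Since the order of \<open>Z\<^sup>B\<close> is reversed in \<open>K\<close>, the limit is formed as a pointwise weighted colimit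
  \<open>l\<close> in \<open>Z\<close>. It is a fixed point because the legs \<open>f i \<rightarrow> l\<close>, present to the degree \<open>w i\<close>, factor
  through \<open>up (lo l)\<close>: every \<open>f i\<close> is a fixed point, so maps from it into \<open>l\<close> and into
  \<open>up (lo l)\<close> correspond.
\<close>

lemma K_has_wlim:
  assumes f: "f \<in> I \<rightarrow> vobj K"
  shows "\<exists>l. is_wlim K I w f l"
proof -
  have f_fun: "f i b \<in> vobj Z" if "i \<in> I" "b \<in> vobj B" for i b
    using f that K_fun by (fastforce simp: Pi_iff)
  have "\<forall>b\<in>vobj B. \<exists>s. is_wcolim Z I w (\<lambda>i. f i b) s"
    using f_fun by (intro ballI vcomplete_has_wcolim[OF cat_Z complete_Z]) auto
  then obtain s where s: "\<And>b. b \<in> vobj B \<Longrightarrow> is_wcolim Z I w (\<lambda>i. f i b) (s b)" by metis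
  define l where "l = restrict s (vobj B)"
  have l: "l \<in> vobj B \<rightarrow> vobj Z" using s by (auto simp: l_def is_wcolim_def)
  have l_hom: "vhom Z (l b) z = (INF i\<in>I. qimp (w i) (vhom Z (f i b) z))"
    if "b \<in> vobj B" "z \<in> vobj Z" for b z
    using s that by (simp add: l_def is_wcolim_def)
  have lim: "vhom K \<kappa> l = (INF i\<in>I. qimp (w i) (vhom K \<kappa> (f i)))"
    if \<kappa>: "\<kappa> \<in> vobj B \<rightarrow> vobj Z" for \<kappa>
  proof -
    have "vhom K \<kappa> l = (INF b\<in>vobj B. INF i\<in>I. qimp (w i) (vhom Z (f i b) (\<kappa> b)))"
      unfolding K_hom using \<kappa> by (intro INF_cong refl l_hom) auto
    also have "\<dots> = (INF i\<in>I. INF b\<in>vobj B. qimp (w i) (vhom Z (f i b) (\<kappa> b)))"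
      by (rule INF_commute)
    finally show ?thesis by (simp add: K_hom qimp_INF)
  qed
  have leg: "w i \<le> vhom Z (f i b) (l b)" if i: "i \<in> I" and b: "b \<in> vobj B" for i b
  proof -
    have "1 \<le> vhom Z (l b) (l b)" using l b by (intro vcategory_refl[OF cat_Z]) auto
    also have "\<dots> = (INF i\<in>I. qimp (w i) (vhom Z (f i b) (l b)))" using l b by (intro l_hom) auto
    finally show ?thesis using i by (simp add: le_INF_iff one_le_qimp_iff)
  qed
  have "l \<in> vobj K" unfolding K_obj_iff
  proof (intro conjI ballI)
    show "l \<in> extensional (vobj B)" by (simp add: l_def)
    show "vfunctor B Z l" unfolding vfunctor_def
    proof (intro conjI ballI l)
      fix b b' assume b: "b \<in> vobj B" "b' \<in> vobj B"
      have "vhom B b b' * w i \<le> vhom Z (f i b) (l b')" if i: "i \<in> I" for i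
      proof -
        have "vfunctor B Z (f i)" using f i by (auto simp: K_obj_iff)
        then have "vhom B b b' * w i \<le> vhom Z (f i b) (f i b') * vhom Z (f i b') (l b')"
          using b i leg by (intro quantale_mult_mono vfunctor_hom) auto
        also have "\<dots> \<le> vhom Z (f i b) (l b')"
          using f_fun i b l by (intro vcategory_comp[OF cat_Z]) auto
        finally show ?thesis .
      qed
      then show "vhom B b b' \<le> vhom Z (l b) (l b')"
        using l b by (subst l_hom) (auto simp: le_INF_iff times_le_iff_le_qimp)
    qed
    fix b assume b: "b \<in> vobj B"
    have "w i \<le> vhom Z (f i b) (up (lo l) b)" if i: "i \<in> I" for i
    proof -
      have fi: "f i \<in> vobj K" using f i by auto
      have "w i \<le> (INF b\<in>vobj B. vhom Z (f i b) (l b))" using leg i by (simp add: le_INF_iff)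
      also have "\<dots> = vhom K l (f i)" by (simp add: K_hom)
      also have "\<dots> = (INF a\<in>vobj A. vhom Y (lo (f i) a) (lo l a))"
        using l fi by (rule K_hom_lo)
      also have "\<dots> \<le> (INF a\<in>vobj A. vhom Y (lo (f i) a) (lo (up (lo l)) a))"
        using l K_fun[OF fi]
        by (intro INF_superset_mono order_refl vhom_le_postcomp[OF cat_Y] le_lo_up)
          (auto intro!: lo_obj up_obj lo_fun)
      also have "\<dots> = vhom K (up (lo l)) (f i)"
        using l fi by (intro K_hom_lo[symmetric] up_fun lo_fun)
      also have "\<dots> \<le> vhom Z (f i b) (up (lo l) b)"
        unfolding K_hom using b by (rule INF_lower)
      finally show ?thesis .
    qed
    then show "vle Z (l b) (up (lo l) b)"
      using l b by (simp add: vle_def l_hom up_obj lo_fun le_INF_iff one_le_qimp_iff)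
  qed
  then show ?thesis using lim K_fun by (auto simp: is_wlim_def)
qed

text \<open>
  Up to isomorphism, \<open>\<zeta>(-,b) \<searrow> z\<close> is \<open>lo\<close> of the functor \<open>B \<rightarrow> Z\<close> cofreely generated by \<open>z\<close> at \<open>b\<close>, and
  \<open>\<zeta>(a,-) \<circledast> y\<close> is \<open>up\<close> of the functor \<open>A \<rightarrow> Y\<close> freely generated by \<open>y\<close> at \<open>a\<close>. Writing them in this
  closed form avoids constructing these functors.
\<close>

definition beta :: "'b \<times> 'z \<Rightarrow> 'b \<Rightarrow> 'z" where
  "beta = (\<lambda>(b, z). up (\<lambda>a. se (\<zeta> (a, b), z)))"

definition alpha :: "'a \<times> 'y \<Rightarrow> 'b \<Rightarrow> 'z" where
  "alpha = (\<lambda>(a, y). \<lambda>b\<in>vobj B. ostar (\<zeta> (a, b), y))"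

lemma beta_obj:
  assumes "b \<in> vobj B" "z \<in> vobj Z"
  shows "beta (b, z) \<in> vobj K"
  using assms by (auto simp: beta_def intro!: up_in_K se_obj zeta_obj)

text \<open>
  One inequality evaluates at \<open>b\<close> and uses \<open>up \<nu> b \<le> z\<close> for \<open>\<nu> = \<zeta>(-,b) \<searrow> z\<close>. For the other, the
  hom out of the fixed point \<open>\<kappa>\<close> is a meet of homs into \<open>\<nu>\<close>, and \<open>\<nu> \<le> lo (up \<nu>)\<close>.
\<close>

lemma K_hom_beta:
  assumes \<kappa>: "\<kappa> \<in> vobj K" and b: "b \<in> vobj B" and z: "z \<in> vobj Z"
  shows "vhom K (beta (b, z)) \<kappa> = vhom Z (\<kappa> b) z"
proof (rule antisym)
  define \<nu> where "\<nu> = (\<lambda>a. se (\<zeta> (a, b), z))"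
  have \<nu>: "\<nu> \<in> vobj A \<rightarrow> vobj Y" using b z by (auto simp: \<nu>_def intro!: se_obj zeta_obj)
  have beta: "beta (b, z) = up \<nu>" by (simp add: beta_def \<nu>_def)
  note \<kappa>_fun = K_fun[OF \<kappa>]
  have \<kappa>b: "\<kappa> b \<in> vobj Z" using \<kappa>_fun b by auto
  have le: "vle Z (up \<nu> b) z"
    using \<nu> b z vcategory_refl[OF cat_Y] by (auto simp: vle_def up_hom le_INF_iff \<nu>_def Pi_iff)
  have "vhom K (beta (b, z)) \<kappa> \<le> vhom Z (\<kappa> b) (up \<nu> b)"
    unfolding beta K_hom using b by (rule INF_lower)
  also have "\<dots> \<le> vhom Z (\<kappa> b) z"
    using \<kappa>b z up_obj[OF \<nu> b] le by (intro vhom_le_postcomp[OF cat_Z])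
  finally show "vhom K (beta (b, z)) \<kappa> \<le> vhom Z (\<kappa> b) z" .
  have "vhom Z (\<kappa> b) z = (INF a\<in>vobj A. vhom Y (lo \<kappa> a) (\<nu> a))"
    using K_hom_out[OF \<kappa> b z] by (simp add: \<nu>_def)
  also have "\<dots> \<le> (INF a\<in>vobj A. vhom Y (lo \<kappa> a) (lo (up \<nu>) a))"
    using \<nu> \<kappa>_fun by (intro INF_superset_mono order_refl vhom_le_postcomp[OF cat_Y] le_lo_up)
      (auto intro!: lo_obj up_obj)
  also have "\<dots> = vhom K (beta (b, z)) \<kappa>"
    unfolding beta using \<nu> \<kappa> by (intro K_hom_lo[symmetric] up_fun)
  finally show "vhom Z (\<kappa> b) z \<le> vhom K (beta (b, z)) \<kappa>" .
qed

lemma K_hom_alpha: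
  assumes \<kappa>: "\<kappa> \<in> vobj B \<rightarrow> vobj Z" and a: "a \<in> vobj A" and y: "y \<in> vobj Y"
  shows "vhom K \<kappa> (alpha (a, y)) = vhom Y y (lo \<kappa> a)"
proof -
  have "vhom K \<kappa> (alpha (a, y)) = (INF b\<in>vobj B. vhom Y y (se (\<zeta> (a, b), \<kappa> b)))"
    unfolding K_hom using \<kappa> a y
    by (intro INF_cong refl) (auto simp: alpha_def Pi_iff intro!: transpose zeta_obj)
  then show ?thesis using \<kappa> a y by (simp add: lo_hom)
qed

text \<open>
  The identity of \<open>alpha(a,y)\<close>, seen through \<open>K_hom_alpha\<close>, says \<open>y \<le> lo (alpha(a,y)) a\<close>. This bounds
  \<open>\<zeta>(a,b) \<circledast> y\<close> by the member at \<open>a\<close> of the join that defines \<open>up (lo (alpha(a,y))) b\<close>.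
\<close>

lemma alpha_obj:
  assumes a: "a \<in> vobj A" and y: "y \<in> vobj Y"
  shows "alpha (a, y) \<in> vobj K"
proof -
  let ?\<kappa> = "alpha (a, y)"
  have \<kappa>: "?\<kappa> \<in> vobj B \<rightarrow> vobj Z"
    using a y by (auto simp: alpha_def intro!: ostar_obj zeta_obj)
  have "vfunctor B Z ?\<kappa>" unfolding vfunctor_def
  proof (intro conjI ballI \<kappa>)
    fix b b' assume b: "b \<in> vobj B" "b' \<in> vobj B"
    have "vhom B b b' * 1 \<le> vhom X (\<zeta> (a, b)) (\<zeta> (a, b')) * vhom Y y y"
      using a y b by (intro quantale_mult_mono zeta_hom_right vcategory_refl[OF cat_Y])
    also have "\<dots> \<le> vhom Z (ostar (\<zeta> (a, b), y)) (ostar (\<zeta> (a, b'), y))"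
      using a y b by (intro ostar_hom zeta_obj)
    finally show "vhom B b b' \<le> vhom Z (?\<kappa> b) (?\<kappa> b')" using b by (simp add: alpha_def)
  qed
  moreover have "vle Z (?\<kappa> b) (up (lo ?\<kappa>) b)" if b: "b \<in> vobj B" for b
  proof -
    have "1 \<le> vhom K ?\<kappa> ?\<kappa>"
      using \<kappa> by (auto simp: K_hom le_INF_iff intro!: vcategory_refl[OF cat_Z])
    then have "vle Y y (lo ?\<kappa> a)" using K_hom_alpha[OF \<kappa> a y] by (simp add: vle_def)
    then have "vle Y y (se (\<zeta> (a, b), up (lo ?\<kappa>) b))"
      using \<kappa> a b y
      by (intro vle_trans[OF cat_Y _ _ _ _ le_se_up[OF lo_fun[OF \<kappa>] a b]] lo_obj se_obj
          up_obj lo_fun zeta_obj)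
    then show ?thesis
      using a b y \<kappa> by (simp add: vle_def alpha_def transpose zeta_obj up_obj lo_fun)
  qed
  ultimately show ?thesis by (simp add: K_obj_iff alpha_def)
qed

lemma beta_functor: "vfunctor (vtensor B (vop Z)) K beta"
  unfolding vfunctor_def
proof (intro conjI ballI)
  show "beta \<in> vobj (vtensor B (vop Z)) \<rightarrow> vobj K" using beta_obj by auto
  fix p q assume "p \<in> vobj (vtensor B (vop Z))" "q \<in> vobj (vtensor B (vop Z))"
  then obtain b z b' z' where pq: "p = (b, z)" "q = (b', z')"
    and b: "b \<in> vobj B" "b' \<in> vobj B" and z: "z \<in> vobj Z" "z' \<in> vobj Z" by auto
  let ?\<kappa> = "beta (b', z')"
  have \<kappa>: "?\<kappa> \<in> vobj K" using b z by (intro beta_obj)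
  then have \<kappa>b: "?\<kappa> b \<in> vobj Z" "?\<kappa> b' \<in> vobj Z" using K_fun[OF \<kappa>] b by auto
  have "vle Z (?\<kappa> b') z'"
    using vcategory_refl[OF K_category \<kappa>] K_hom_beta[OF \<kappa> b(2) z(2)] by (simp add: vle_def)
  have "vhom B b b' * vhom Z z' z \<le> vhom Z (?\<kappa> b) (?\<kappa> b') * vhom Z z' z"
    using \<kappa> b by (intro quantale_mult_mono order_refl vfunctor_hom[of B Z]) (auto simp: K_obj_iff)
  also have "\<dots> \<le> vhom Z (?\<kappa> b) z' * vhom Z z' z"
    using \<open>vle Z (?\<kappa> b') z'\<close> \<kappa>b z by (intro quantale_mult_mono order_refl vhom_le_postcomp[OF cat_Z])
  also have "\<dots> \<le> vhom Z (?\<kappa> b) z" using \<kappa>b z by (intro vcategory_comp[OF cat_Z])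
  finally show "vhom (vtensor B (vop Z)) p q \<le> vhom K (beta p) (beta q)"
    using K_hom_beta[OF \<kappa> b(1) z(1)] by (simp add: pq)
qed

lemma alpha_functor: "vfunctor (vtensor A (vop Y)) K alpha"
  unfolding vfunctor_def
proof (intro conjI ballI)
  show "alpha \<in> vobj (vtensor A (vop Y)) \<rightarrow> vobj K" using alpha_obj by auto
  fix p q assume "p \<in> vobj (vtensor A (vop Y))" "q \<in> vobj (vtensor A (vop Y))"
  then obtain a y a' y' where pq: "p = (a, y)" "q = (a', y')"
    and a: "a \<in> vobj A" "a' \<in> vobj A" and y: "y \<in> vobj Y" "y' \<in> vobj Y" by auto
  have "vhom A a a' * vhom Y y' y \<le> vhom Z (alpha (a', y') b) (alpha (a, y) b)"
    if b: "b \<in> vobj B" for b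
  proof -
    have "vhom A a a' * vhom Y y' y \<le> vhom X (\<zeta> (a', b)) (\<zeta> (a, b)) * vhom Y y' y"
      using a b by (intro quantale_mult_mono order_refl zeta_hom_left)
    also have "\<dots> \<le> vhom Z (ostar (\<zeta> (a', b), y')) (ostar (\<zeta> (a, b), y))"
      using a b y by (intro ostar_hom zeta_obj)
    finally show ?thesis using b by (simp add: alpha_def)
  qed
  then show "vhom (vtensor A (vop Y)) p q \<le> vhom K (alpha p) (alpha q)"
    by (simp add: pq K_hom le_INF_iff)
qed

lemma beta_dense: "vdense (vtensor B (vop Z)) K beta"
proof -
  have "vhom K \<kappa> \<kappa>' = (INF p\<in>vobj B \<times> vobj Z. qimp (vhom K (beta p) \<kappa>) (vhom K (beta p) \<kappa>'))"
    if \<kappa>: "\<kappa> \<in> vobj K" "\<kappa>' \<in> vobj K" for \<kappa> \<kappa>'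
    unfolding K_hom[of \<kappa> \<kappa>'] INF_Times
  proof (intro INF_cong refl)
    fix b assume b: "b \<in> vobj B"
    have "vhom Z (\<kappa>' b) (\<kappa> b) = (INF z\<in>vobj Z. qimp (vhom Z (\<kappa> b) z) (vhom Z (\<kappa>' b) z))"
      using K_fun \<kappa> b by (intro yoneda_covariant[symmetric] cat_Z) auto
    then show "vhom Z (\<kappa>' b) (\<kappa> b) =
        (INF z\<in>vobj Z. qimp (vhom K (beta (b, z)) \<kappa>) (vhom K (beta (b, z)) \<kappa>'))"
      using \<kappa> b by (simp add: K_hom_beta cong: INF_cong)
  qed
  then show ?thesis
    by (simp add: vdense_iff[OF K_category beta_functor] is_wcolim_def)
qed

lemma alpha_codense: "vcodense (vtensor A (vop Y)) K alpha"
proof -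
  have "vhom K \<kappa>' \<kappa> = (INF p\<in>vobj A \<times> vobj Y. qimp (vhom K \<kappa> (alpha p)) (vhom K \<kappa>' (alpha p)))"
    if \<kappa>: "\<kappa> \<in> vobj K" "\<kappa>' \<in> vobj K" for \<kappa> \<kappa>'
    unfolding K_hom_lo[OF K_fun[OF \<kappa>(2)] \<kappa>(1)] INF_Times
  proof (intro INF_cong refl)
    fix a assume a: "a \<in> vobj A"
    have "vhom Y (lo \<kappa> a) (lo \<kappa>' a) =
        (INF y\<in>vobj Y. qimp (vhom Y y (lo \<kappa> a)) (vhom Y y (lo \<kappa>' a)))"
      using K_fun \<kappa> a by (intro yoneda_contravariant[symmetric] cat_Y lo_obj) auto
    then show "vhom Y (lo \<kappa> a) (lo \<kappa>' a) =
        (INF y\<in>vobj Y. qimp (vhom K \<kappa> (alpha (a, y))) (vhom K \<kappa>' (alpha (a, y))))"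
      using \<kappa> a by (simp add: K_hom_alpha K_fun cong: INF_cong)
  qed
  then show ?thesis
    by (simp add: vcodense_iff[OF K_category alpha_functor] is_wlim_def)
qed

lemma K_hom_beta_alpha:
  assumes "a \<in> vobj A" "b \<in> vobj B" "y \<in> vobj Y" "z \<in> vobj Z"
  shows "vhom K (beta (b, z)) (alpha (a, y)) = vhom X (\<zeta> (a, b)) (sw (z, y))"
  using assms by (simp add: K_hom_beta alpha_obj zeta_obj transpose) (simp add: alpha_def zeta_obj transpose)

end

section \<open>Recovering the kernel from a dense and a codense bifunctor\<close>

locale kernel_presentation = adjunction_kernel X Y Z A B ostar sw se \<zeta>
  for X :: "('x, 'v::comm_quantale) vcat"
    and Y :: "('y, 'v) vcat"
    and Z :: "('z, 'v) vcat"
    and A :: "('a, 'v) vcat"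
    and B :: "('b, 'v) vcat"
    and ostar :: "'x \<times> 'y \<Rightarrow> 'z"
    and sw :: "'z \<times> 'y \<Rightarrow> 'x"
    and se :: "'x \<times> 'z \<Rightarrow> 'y"
    and \<zeta> :: "'a \<times> 'b \<Rightarrow> 'x" +
  fixes C :: "('c, 'v) vcat"
    and \<beta> :: "'b \<times> 'z \<Rightarrow> 'c"
    and \<alpha> :: "'a \<times> 'y \<Rightarrow> 'c"
  assumes cat_C: "vcategory C" and complete_C: "vcomplete C"
    and \<beta>: "vfunctor (vtensor B (vop Z)) C \<beta>" and \<beta>_dense: "vdense (vtensor B (vop Z)) C \<beta>"
    and \<alpha>: "vfunctor (vtensor A (vop Y)) C \<alpha>" and \<alpha>_codense: "vcodense (vtensor A (vop Y)) C \<alpha>"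
    and hom_\<beta>_\<alpha>: "\<And>a b y z. a \<in> vobj A \<Longrightarrow> b \<in> vobj B \<Longrightarrow> y \<in> vobj Y \<Longrightarrow> z \<in> vobj Z \<Longrightarrow>
      vhom C (\<beta> (b, z)) (\<alpha> (a, y)) = vhom X (\<zeta> (a, b)) (sw (z, y))"
begin

lemma \<beta>_obj: "b \<in> vobj B \<Longrightarrow> z \<in> vobj Z \<Longrightarrow> \<beta> (b, z) \<in> vobj C"
  using vfunctor_obj[OF \<beta>] by simp

lemma \<alpha>_obj: "a \<in> vobj A \<Longrightarrow> y \<in> vobj Y \<Longrightarrow> \<alpha> (a, y) \<in> vobj C"
  using vfunctor_obj[OF \<alpha>] by simp

lemma hom_se:
  assumes "a \<in> vobj A" "b \<in> vobj B" "y \<in> vobj Y" "z \<in> vobj Z"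
  shows "vhom C (\<beta> (b, z)) (\<alpha> (a, y)) = vhom Y y (se (\<zeta> (a, b), z))"
  using assms by (simp add: hom_\<beta>_\<alpha> transpose zeta_obj)

lemma C_hom_by_\<beta>:
  assumes "c \<in> vobj C" "x \<in> vobj C"
  shows "vhom C c x =
    (INF b\<in>vobj B. INF z\<in>vobj Z. qimp (vhom C (\<beta> (b, z)) c) (vhom C (\<beta> (b, z)) x))"
  using \<beta>_dense assms unfolding vdense_iff[OF cat_C \<beta>]
  by (simp add: is_wcolim_def INF_Times)

lemma C_hom_by_\<alpha>:
  assumes "c \<in> vobj C" "x \<in> vobj C"
  shows "vhom C x c =
    (INF a\<in>vobj A. INF y\<in>vobj Y. qimp (vhom C c (\<alpha> (a, y))) (vhom C x (\<alpha> (a, y))))"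
  using \<alpha>_codense assms unfolding vcodense_iff[OF cat_C \<alpha>]
  by (simp add: is_wlim_def INF_Times)

text \<open>
  By codensity \<open>C(\<beta>(b,z), c)\<close> is a weighted meet of the values
  \<open>C(\<beta>(b,z), \<alpha>(a,y)) = Z(\<zeta>(a,b) \<circledast> y, z)\<close>, so the representing object is the colimit in \<open>Z\<close> of
  the objects \<open>\<zeta>(a,b) \<circledast> y\<close> with the same weight.
\<close>

lemma coordinate_exists:
  assumes c: "c \<in> vobj C" and b: "b \<in> vobj B"
  shows "\<exists>w\<in>vobj Z. \<forall>z\<in>vobj Z. vhom Z w z = vhom C (\<beta> (b, z)) c"
proof -
  have "\<exists>w. is_wcolim Z (vobj A \<times> vobj Y) (\<lambda>p. vhom C c (\<alpha> p)) (\<lambda>(a, y). ostar (\<zeta> (a, b), y)) w"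
    using b by (intro vcomplete_has_wcolim[OF cat_Z complete_Z]) (auto intro!: ostar_obj zeta_obj)
  then obtain w where w: "w \<in> vobj Z" "\<And>z. z \<in> vobj Z \<Longrightarrow> vhom Z w z =
      (INF a\<in>vobj A. INF y\<in>vobj Y. qimp (vhom C c (\<alpha> (a, y))) (vhom Z (ostar (\<zeta> (a, b), y)) z))"
    by (auto simp: is_wcolim_def INF_Times)
  have "vhom Z w z = vhom C (\<beta> (b, z)) c" if z: "z \<in> vobj Z" for z
    unfolding w(2)[OF z] C_hom_by_\<alpha>[OF c \<beta>_obj[OF b z]]
    using b z by (intro INF_cong refl) (simp add: hom_se transpose zeta_obj)
  then show ?thesis using w(1) by blast
qed

definition coords :: "'c \<Rightarrow> 'b \<Rightarrow> 'z" where
  "coords c = (\<lambda>b\<in>vobj B. SOME w. w \<in> vobj Z \<and> (\<forall>z\<in>vobj Z. vhom Z w z = vhom C (\<beta> (b, z)) c))"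

lemma
  assumes c: "c \<in> vobj C"
  shows coords_obj: "b \<in> vobj B \<Longrightarrow> coords c b \<in> vobj Z"
    and coords_hom: "b \<in> vobj B \<Longrightarrow> z \<in> vobj Z \<Longrightarrow> vhom Z (coords c b) z = vhom C (\<beta> (b, z)) c"
proof -
  have "coords c b \<in> vobj Z \<and> (\<forall>z\<in>vobj Z. vhom Z (coords c b) z = vhom C (\<beta> (b, z)) c)"
    if b: "b \<in> vobj B" for b
    using someI_ex[OF coordinate_exists[OF c b, unfolded Bex_def]] b by (simp add: coords_def)
  then show "b \<in> vobj B \<Longrightarrow> coords c b \<in> vobj Z"
    and "b \<in> vobj B \<Longrightarrow> z \<in> vobj Z \<Longrightarrow> vhom Z (coords c b) z = vhom C (\<beta> (b, z)) c"
    by blast+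
qed

text \<open>
  Two passes through the Yoneda lemma. Homs from \<open>c\<close> to \<open>\<alpha>(a,y)\<close> come from the colimit and
  yield \<open>lo \<kappa>\<close>; homs from \<open>\<beta>(b,z)\<close> to \<open>c\<close> then come from codensity and yield \<open>up (lo \<kappa>)\<close>.
\<close>

lemma hom_\<beta>_wcolim:
  assumes \<kappa>: "\<kappa> \<in> vobj B \<rightarrow> vobj Z"
    and c: "is_wcolim C (vobj B \<times> vobj Z) (\<lambda>(b, z). vhom Z (\<kappa> b) z) \<beta> c"
    and b: "b \<in> vobj B" and z: "z \<in> vobj Z"
  shows "vhom C (\<beta> (b, z)) c = vhom Z (up (lo \<kappa>) b) z"
proof -
  have c_obj: "c \<in> vobj C" using c by (simp add: is_wcolim_def)
  have lo: "vhom C c (\<alpha> (a, y)) = vhom Y y (lo \<kappa> a)" if a: "a \<in> vobj A" and y: "y \<in> vobj Y" for a y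
  proof -
    have "vhom C c (\<alpha> (a, y)) =
        (INF b\<in>vobj B. INF z\<in>vobj Z. qimp (vhom Z (\<kappa> b) z) (vhom C (\<beta> (b, z)) (\<alpha> (a, y))))"
      using c \<alpha>_obj[OF a y] by (simp add: is_wcolim_def INF_Times)
    also have "\<dots> = (INF b\<in>vobj B. vhom Y y (se (\<zeta> (a, b), \<kappa> b)))"
    proof (intro INF_cong refl)
      fix b assume b: "b \<in> vobj B"
      then have \<kappa>b: "\<kappa> b \<in> vobj Z" using \<kappa> by auto
      have "(INF z\<in>vobj Z. qimp (vhom Z (\<kappa> b) z) (vhom C (\<beta> (b, z)) (\<alpha> (a, y)))) =
          (INF z\<in>vobj Z. qimp (vhom Z (\<kappa> b) z) (vhom Z (ostar (\<zeta> (a, b), y)) z))"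
        using a b y by (intro INF_cong refl) (simp add: hom_se transpose zeta_obj)
      also have "\<dots> = vhom Z (ostar (\<zeta> (a, b), y)) (\<kappa> b)"
        using a b y \<kappa>b by (intro yoneda_covariant[OF cat_Z] ostar_obj zeta_obj)
      finally show "(INF z\<in>vobj Z. qimp (vhom Z (\<kappa> b) z) (vhom C (\<beta> (b, z)) (\<alpha> (a, y)))) =
          vhom Y y (se (\<zeta> (a, b), \<kappa> b))"
        using a b y \<kappa>b by (simp add: transpose zeta_obj)
    qed
    also have "\<dots> = vhom Y y (lo \<kappa> a)" using \<kappa> a y by (simp add: lo_hom)
    finally show ?thesis .
  qed
  have "vhom C (\<beta> (b, z)) c =
      (INF a\<in>vobj A. INF y\<in>vobj Y. qimp (vhom Y y (lo \<kappa> a)) (vhom Y y (se (\<zeta> (a, b), z))))"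
    unfolding C_hom_by_\<alpha>[OF c_obj \<beta>_obj[OF b z]]
    using b z by (intro INF_cong refl) (simp add: lo hom_se)
  also have "\<dots> = (INF a\<in>vobj A. vhom Y (lo \<kappa> a) (se (\<zeta> (a, b), z)))"
    using \<kappa> b z by (intro INF_cong refl yoneda_contravariant[OF cat_Y] se_obj zeta_obj lo_obj)
  also have "\<dots> = vhom Z (up (lo \<kappa>) b) z"
    using \<kappa> b z by (simp add: up_hom lo_fun)
  finally show ?thesis .
qed

text \<open>
  Density makes \<open>c\<close> the colimit of \<open>\<beta>\<close> weighted by its own coordinates, so these agree with their
  image under \<open>up \<circ> lo\<close>.
\<close>

lemma coords_in_K:
  assumes c: "c \<in> vobj C"
  shows "coords c \<in> vobj K"
proof -
  have coords: "coords c \<in> vobj B \<rightarrow> vobj Z" using coords_obj[OF c] by auto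
  have "is_wcolim C (vobj B \<times> vobj Z) (\<lambda>(b, z). vhom Z (coords c b) z) \<beta> c"
    using c C_hom_by_\<beta>[OF c] by (simp add: is_wcolim_def INF_Times coords_hom cong: INF_cong)
  then have eq: "vhom Z (coords c b) z = vhom Z (up (lo (coords c)) b) z" if "b \<in> vobj B" "z \<in> vobj Z" for b z
    using hom_\<beta>_wcolim[OF coords _ that] coords_hom[OF c that] by simp
  then have "viso Z (coords c b) (up (lo (coords c)) b)" if "b \<in> vobj B" for b
    using that coords by (intro viso_if_vhom_eq[OF cat_Z]) (auto intro!: up_obj lo_fun)
  moreover have "vfunctor B Z (coords c)" unfolding vfunctor_def
  proof (intro conjI ballI coords)
    fix b b' assume b: "b \<in> vobj B" "b' \<in> vobj B"
    let ?z = "coords c b'"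
    have z: "?z \<in> vobj Z" using b coords by auto
    have "vhom B b b' * 1 \<le> vhom B b b' * vhom Z ?z ?z"
      using z by (intro quantale_mult_mono order_refl vcategory_refl[OF cat_Z])
    also have "\<dots> \<le> vhom C (\<beta> (b, ?z)) (\<beta> (b', ?z))"
      using vfunctor_hom[OF \<beta>, of "(b, ?z)" "(b', ?z)"] b z by simp
    also have "\<dots> \<le> vhom C (\<beta> (b, ?z)) c"
      using coords_hom[OF c b(2) z] vcategory_refl[OF cat_Z z] b z c
      by (intro vhom_le_postcomp[OF cat_C] \<beta>_obj) (simp_all add: vle_def)
    also have "\<dots> = vhom Z (coords c b) ?z" using coords_hom[OF c b(1) z] by simp
    finally show "vhom B b b' \<le> vhom Z (coords c b) (coords c b')" by simp
  qed
  ultimately show ?thesis by (simp add: K_obj_iff viso_def coords_def)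
qed

lemma coords_fully_faithful:
  assumes c: "c \<in> vobj C" "c' \<in> vobj C"
  shows "vhom K (coords c) (coords c') = vhom C c c'"
  unfolding K_hom C_hom_by_\<beta>[OF c]
proof (intro INF_cong refl)
  fix b assume b: "b \<in> vobj B"
  have "vhom Z (coords c' b) (coords c b) = (INF z\<in>vobj Z. qimp (vhom Z (coords c b) z) (vhom Z (coords c' b) z))"
    using b c by (intro yoneda_covariant[symmetric] cat_Z coords_obj)
  then show "vhom Z (coords c' b) (coords c b) =
      (INF z\<in>vobj Z. qimp (vhom C (\<beta> (b, z)) c) (vhom C (\<beta> (b, z)) c'))"
    using b c by (simp add: coords_hom cong: INF_cong)
qed

text \<open>
  A fixed point \<open>\<kappa>\<close> is hit by the colimit of \<open>\<beta>\<close> weighted by \<open>Z(\<kappa> b, z)\<close>: its coordinates are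
  \<open>up (lo \<kappa>)\<close>, which is isomorphic to \<open>\<kappa>\<close>.
\<close>

lemma coords_essentially_surjective:
  assumes \<kappa>: "\<kappa> \<in> vobj K"
  shows "\<exists>c\<in>vobj C. viso K (coords c) \<kappa>"
proof -
  note \<kappa>_fun = K_fun[OF \<kappa>]
  obtain c where colim: "is_wcolim C (vobj B \<times> vobj Z) (\<lambda>(b, z). vhom Z (\<kappa> b) z) \<beta> c"
    using vcomplete_has_wcolim[OF cat_C complete_C, of \<beta> "vobj B \<times> vobj Z"] \<beta>_obj by blast
  then have c: "c \<in> vobj C" by (simp add: is_wcolim_def)
  have "viso Z (coords c b) (\<kappa> b)" if b: "b \<in> vobj B" for b
  proof (rule viso_if_vhom_eq[OF cat_Z])
    show "coords c b \<in> vobj Z" "\<kappa> b \<in> vobj Z" using coords_obj[OF c b] \<kappa>_fun b by auto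
    fix z assume z: "z \<in> vobj Z"
    have "vhom Z (coords c b) z = vhom Z (up (lo \<kappa>) b) z"
      using coords_hom[OF c b z] hom_\<beta>_wcolim[OF \<kappa>_fun colim b z] by simp
    also have "\<dots> = vhom Z (\<kappa> b) z"
      using K_hom_out[OF \<kappa> b z] up_hom[OF lo_fun[OF \<kappa>_fun] b z] by simp
    finally show "vhom Z (coords c b) z = vhom Z (\<kappa> b) z" .
  qed
  then have "viso K (coords c) \<kappa>" by (simp add: viso_def vle_def K_hom le_INF_iff)
  then show ?thesis using c by blast
qed

lemma equivalent_to_K: "vequivalent C K"
  using coords_in_K coords_fully_faithful coords_essentially_surjective
  by (intro vequivalentI[OF cat_C K_category])

end

section \<open>The characterization\<close>

theorem corollary6p7:
  fixes X :: "('x, 'v::comm_quantale) vcat"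
    and Y :: "('y, 'v) vcat"
    and Z :: "('z, 'v) vcat"
    and A :: "('a, 'v) vcat"
    and B :: "('b, 'v) vcat"
    and C :: "('c, 'v) vcat"
    and ostar :: "'x \<times> 'y \<Rightarrow> 'z"
    and sw :: "'z \<times> 'y \<Rightarrow> 'x"
    and se :: "'x \<times> 'z \<Rightarrow> 'y"
    and \<zeta> :: "'a \<times> 'b \<Rightarrow> 'x"
  assumes "vcategory X" "vcomplete X"
    and "vcategory Y" "vcomplete Y"
    and "vcategory Z" "vcomplete Z"
    and "two_variable_adjunction X Y Z ostar sw se"
    and "vcategory A" and "vcategory B"
    and "vfunctor (vtensor (vop A) B) X \<zeta>"
    and "vcategory C"
  shows "vequivalent C (K_dagger A B Y Z ostar se \<zeta>) \<longleftrightarrow>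
    vcomplete C \<and>
    (\<exists>\<beta> \<alpha>.
       vfunctor (vtensor B (vop Z)) C \<beta> \<and> vdense (vtensor B (vop Z)) C \<beta> \<and>
       vfunctor (vtensor A (vop Y)) C \<alpha> \<and> vcodense (vtensor A (vop Y)) C \<alpha> \<and>
       (\<forall>a\<in>vobj A. \<forall>b\<in>vobj B. \<forall>y\<in>vobj Y. \<forall>z\<in>vobj Z.
          vhom C (\<beta> (b, z)) (\<alpha> (a, y)) = vhom X (\<zeta> (a, b)) (sw (z, y))))"
proof -
  interpret adjunction_kernel X Y Z A B ostar sw se \<zeta>
    using assms by unfold_locales
  show ?thesis
  proof
    assume "vequivalent C K"
    then obtain f g where f: "vfunctor C K f" and g: "vfunctor K C g"
      and ff: "\<And>c c'. c \<in> vobj C \<Longrightarrow> c' \<in> vobj C \<Longrightarrow> vhom K (f c) (f c') = vhom C c c'"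
      and f_adj_g: "\<And>c k. c \<in> vobj C \<Longrightarrow> k \<in> vobj K \<Longrightarrow> vhom K (f c) k = vhom C c (g k)"
      and g_adj_f: "\<And>c k. c \<in> vobj C \<Longrightarrow> k \<in> vobj K \<Longrightarrow> vhom K k (f c) = vhom C (g k) c"
      and gg: "\<And>k k'. k \<in> vobj K \<Longrightarrow> k' \<in> vobj K \<Longrightarrow> vhom C (g k) (g k') = vhom K k k'"
      using vequivalentE[OF \<open>vcategory C\<close> K_category] by blast
    note fo = vfunctor_obj[OF f] and go = vfunctor_obj[OF g]
    \<comment> \<open>the infimum of \<open>\<phi>\<close> in \<open>C\<close> is the image under \<open>g\<close> of the limit of \<open>f\<close> in \<open>K\<close> weighted by \<open>\<phi>\<close>\<close>
    have "vcomplete C" unfolding vcomplete_def is_vinf_eq_is_wlim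
    proof
      fix \<phi> assume "\<phi> \<in> vobj (vfun_cat C vbase)"
      obtain l where l: "is_wlim K (vobj C) \<phi> f l" using K_has_wlim[of f "vobj C" \<phi>] fo by auto
      have "vhom C c (g l) = (INF c'\<in>vobj C. qimp (\<phi> c') (vhom C c c'))" if c: "c \<in> vobj C" for c
        using l c fo f_adj_g[of c l, symmetric] by (simp add: is_wlim_def ff cong: INF_cong)
      then have "is_wlim C (vobj C) \<phi> (\<lambda>c. c) (g l)"
        using l go by (simp add: is_wlim_def)
      then show "\<exists>i. is_wlim C (vobj C) \<phi> (\<lambda>c. c) i" ..
    qed
    moreover have "vfunctor (vtensor B (vop Z)) C (g \<circ> beta)"
      using beta_functor g by (rule vfunctor_comp)
    moreover have "vdense (vtensor B (vop Z)) C (g \<circ> beta)"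
      using \<open>vcategory C\<close> K_category beta_functor g fo ff g_adj_f beta_dense
      by (rule vdense_transport)
    moreover have "vfunctor (vtensor A (vop Y)) C (g \<circ> alpha)"
      using alpha_functor g by (rule vfunctor_comp)
    moreover have "vcodense (vtensor A (vop Y)) C (g \<circ> alpha)"
      using \<open>vcategory C\<close> K_category alpha_functor g fo ff f_adj_g alpha_codense
      by (rule vcodense_transport)
    moreover have "vhom C ((g \<circ> beta) (b, z)) ((g \<circ> alpha) (a, y)) = vhom X (\<zeta> (a, b)) (sw (z, y))"
      if "a \<in> vobj A" "b \<in> vobj B" "y \<in> vobj Y" "z \<in> vobj Z" for a b y z
      using that gg[OF beta_obj alpha_obj] by (simp add: K_hom_beta_alpha)
    ultimately show "vcomplete C \<and> (\<exists>\<beta> \<alpha>.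
       vfunctor (vtensor B (vop Z)) C \<beta> \<and> vdense (vtensor B (vop Z)) C \<beta> \<and>
       vfunctor (vtensor A (vop Y)) C \<alpha> \<and> vcodense (vtensor A (vop Y)) C \<alpha> \<and>
       (\<forall>a\<in>vobj A. \<forall>b\<in>vobj B. \<forall>y\<in>vobj Y. \<forall>z\<in>vobj Z.
          vhom C (\<beta> (b, z)) (\<alpha> (a, y)) = vhom X (\<zeta> (a, b)) (sw (z, y))))"
      by blast
  next
    assume "vcomplete C \<and> (\<exists>\<beta> \<alpha>.
       vfunctor (vtensor B (vop Z)) C \<beta> \<and> vdense (vtensor B (vop Z)) C \<beta> \<and>
       vfunctor (vtensor A (vop Y)) C \<alpha> \<and> vcodense (vtensor A (vop Y)) C \<alpha> \<and>
       (\<forall>a\<in>vobj A. \<forall>b\<in>vobj B. \<forall>y\<in>vobj Y. \<forall>z\<in>vobj Z.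
          vhom C (\<beta> (b, z)) (\<alpha> (a, y)) = vhom X (\<zeta> (a, b)) (sw (z, y))))"
    then obtain \<beta> \<alpha> where complete: "vcomplete C" and presentation:
        "vfunctor (vtensor B (vop Z)) C \<beta>" "vdense (vtensor B (vop Z)) C \<beta>"
        "vfunctor (vtensor A (vop Y)) C \<alpha>" "vcodense (vtensor A (vop Y)) C \<alpha>"
      and hom: "\<forall>a\<in>vobj A. \<forall>b\<in>vobj B. \<forall>y\<in>vobj Y. \<forall>z\<in>vobj Z.
        vhom C (\<beta> (b, z)) (\<alpha> (a, y)) = vhom X (\<zeta> (a, b)) (sw (z, y))"
      by blast
    have "kernel_presentation X Y Z A B ostar sw se \<zeta> C \<beta> \<alpha>"
      using \<open>vcategory C\<close> complete presentation hom by unfold_locales auto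
    then show "vequivalent C K" by (rule kernel_presentation.equivalent_to_K)
  qed
qed

end
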